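(* Let $H$ be a non-normal maximal subgroup of a finite solvable group $G$ and let $\omega \subset \pi(F(H/\mathrm{Core}_G H))$. Then $G$ has a Hall $\omega$-subgroup $G_{\omega}$ such that $N_G(G_{\omega}) \subseteq H$.
   Context: All groups are finite. $F(X)$ denotes the Fitting subgroup of a group $X$; $\pi(Y)$ denotes the set of all prime divisors of $|Y|$ for a group $Y$; $\mathrm{Core}_G H = \bigcap_{g\in G} H^g$ is the core of $H$ in $G$, i.e. the largest normal subgroup of $G$ contained in $H$; $N_G(X)$ is the normalizer of $X$ in $G$. For a set $\omega$ of primes, a Hall $\omega$-subgroup of $G$ is a subgroup whose order has all its prime divisors in $\omega$ and whose index in $G$ has no prime divisor in $\omega$.
   Formalization: The set ω is assumed nonempty: for ω = ∅ the only Hall ω-subgroup is the trivial group, whose normalizer is G and is not contained in H, so the claim fails there. *)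

theory Defs
  imports "HOL-Algebra.Solvable_Groups" "HOL-Algebra.Group_Action"
    "HOL-Computational_Algebra.Primes"
begin

definition maximal_subgroup :: "'a set \<Rightarrow> ('a, 'b) monoid_scheme \<Rightarrow> bool" where
  "maximal_subgroup H G \<longleftrightarrow>
     subgroup H G \<and> H \<noteq> carrier G \<and>
     (\<forall>K. subgroup K G \<longrightarrow> H \<subseteq> K \<longrightarrow> K = H \<or> K = carrier G)"

definition core :: "('a, 'b) monoid_scheme \<Rightarrow> 'a set \<Rightarrow> 'a set" where
  "core G H = (\<Inter>g\<in>carrier G. (inv\<^bsub>G\<^esub> g) <#\<^bsub>G\<^esub> H #>\<^bsub>G\<^esub> g)"

definition commutator_subgroup ::
    "('a, 'b) monoid_scheme \<Rightarrow> 'a set \<Rightarrow> 'a set \<Rightarrow> 'a set" where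
  "commutator_subgroup G H K =
     generate G (\<Union>h\<in>H. \<Union>k\<in>K. {h \<otimes>\<^bsub>G\<^esub> k \<otimes>\<^bsub>G\<^esub> inv\<^bsub>G\<^esub> h \<otimes>\<^bsub>G\<^esub> inv\<^bsub>G\<^esub> k})"

primrec lower_central :: "('a, 'b) monoid_scheme \<Rightarrow> nat \<Rightarrow> 'a set" where
  "lower_central G 0 = carrier G"
| "lower_central G (Suc n) = commutator_subgroup G (lower_central G n) (carrier G)"

definition nilpotent :: "('a, 'b) monoid_scheme \<Rightarrow> bool" where
  "nilpotent G \<longleftrightarrow> (\<exists>n. lower_central G n = {\<one>\<^bsub>G\<^esub>})"

text \<open>For a finite group the subgroup generated by all nilpotent normal subgroups is itself
  nilpotent (Fitting), hence the largest nilpotent normal subgroup.\<close>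

definition fitting :: "('a, 'b) monoid_scheme \<Rightarrow> 'a set" where
  "fitting G = generate G (\<Union>{N. N \<lhd> G \<and> nilpotent (G\<lparr>carrier := N\<rparr>)})"

text \<open>Only meaningful for finite \<open>G\<close>: otherwise \<open>card\<close> may be \<open>0\<close>, and
  \<open>prime_factors 0\<close> is empty.\<close>

definition hall_subgroup :: "nat set \<Rightarrow> 'a set \<Rightarrow> ('a, 'b) monoid_scheme \<Rightarrow> bool" where
  "hall_subgroup \<omega> K G \<longleftrightarrow>
     subgroup K G \<and>
     prime_factors (card K) \<subseteq> \<omega> \<and>
     prime_factors (card (rcosets\<^bsub>G\<^esub> K)) \<inter> \<omega> = {}"

end

theory Submission
  imports Defs "HOL-Algebra.Sylow" "HOL-Algebra.SndIsomorphismGrp"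
    "HOL-Algebra.Multiplicative_Group" "HOL-Number_Theory.Cong"
begin

text \<open>
  Let \<open>C\<close> be the core of \<open>H\<close>. In \<open>G/C\<close> the maximal subgroup \<open>H/C\<close> has trivial core, so a nontrivial
  normal abelian \<open>r\<close>-subgroup \<open>A\<close> of \<open>G/C\<close>, which exists by solvability, is a complement of \<open>H/C\<close>;
  in particular \<open>H\<close> has \<open>r\<close>-power index in \<open>G\<close>.

  The key point (lemma \<open>core_free_maximal_subgroup\<close>) is that \<open>C\<^sub>A(Q) = 1\<close> for each nontrivial normal
  subgroup \<open>Q\<close> of \<open>H/C\<close>: this centralizer is normal in \<open>G/C\<close>, so if it were nontrivial it would
  supplement \<open>H/C\<close>, and \<open>Q\<close> would be normal in \<open>G/C\<close>. There are two consequences. First, \<open>Q\<close> is not an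
  \<open>r\<close>-group, because an \<open>r\<close>-group acting on \<open>A\<close> fixes a nontrivial element. Second, if
  \<open>Q \<subseteq> K \<subseteq> H/C\<close> and \<open>g = ah\<close> normalizes \<open>K\<close>, where \<open>a \<in> A\<close> and \<open>h \<in> H/C\<close>, then \<open>[a, Q]\<close> lies in
  \<open>A \<inter> H/C = 1\<close>; hence \<open>a = 1\<close> and \<open>g \<in> H/C\<close>.

  For each \<open>q \<in> \<omega>\<close> the group \<open>H/C\<close> has a nontrivial normal \<open>q\<close>-subgroup, since \<open>q\<close> divides the order of
  its Fitting subgroup (lemma \<open>fitting_prime_imp_normal_p_subgroup\<close>). By the first consequence
  \<open>r \<notin> \<omega>\<close>, so a Hall \<open>\<omega>\<close>-subgroup \<open>K\<close> of \<open>H\<close> (theorem \<open>solvable_has_hall_subgroup\<close>) is one of \<open>G\<close>. As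
  \<open>\<omega>\<close> is nonempty, the image of \<open>K\<close> contains some such normal \<open>q\<close>-subgroup, and the second
  consequence puts the normalizer of \<open>K\<close> into \<open>H\<close>.
\<close>

section \<open>Orders of products and images of subgroups\<close>

lemma card_eq_card_image_times_fibre:
  assumes "finite A" and "\<And>a. a \<in> A \<Longrightarrow> card {x \<in> A. f x = f a} = c"
  shows "card A = card (f ` A) * c"
proof -
  have "card A = (\<Sum>y\<in>f ` A. card {x \<in> A. f x = y})"
    using sum.image_gen[OF assms(1), of "\<lambda>_. 1::nat" f] by simp
  also have "\<dots> = (\<Sum>y\<in>f ` A. c)"
    using assms(2) by (intro sum.cong) auto
  finally show ?thesis by simp
qed

lemma (in group) card_set_mult_subgroups:
  assumes H: "subgroup H G" and K: "subgroup K G" and fin: "finite H" "finite K"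
  shows "card (H <#> K) * card (H \<inter> K) = card H * card K"
proof -
  interpret H: subgroup H G by fact
  interpret K: subgroup K G by fact
  let ?f = "\<lambda>(h, k). h \<otimes> k"
  have fib: "card {x \<in> H \<times> K. ?f x = ?f a} = card (H \<inter> K)" if aHK: "a \<in> H \<times> K" for a
  proof -
    obtain h k where a: "a = (h, k)" "h \<in> H" "k \<in> K" using aHK by auto
    have "bij_betw (\<lambda>t. (h \<otimes> t, inv t \<otimes> k)) (H \<inter> K) {x \<in> H \<times> K. ?f x = ?f a}"
    proof (rule bij_betwI[where g = "\<lambda>x. inv h \<otimes> fst x"])
      show "(\<lambda>t. (h \<otimes> t, inv t \<otimes> k)) \<in> H \<inter> K \<rightarrow> {x \<in> H \<times> K. ?f x = ?f a}"
      proof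
        fix t assume t: "t \<in> H \<inter> K"
        have "h \<otimes> t \<otimes> (inv t \<otimes> k) = h \<otimes> k"
          using t a by (metis H.mem_carrier IntE K.mem_carrier inv_closed inv_solve_left m_assoc m_closed)
        then show "(h \<otimes> t, inv t \<otimes> k) \<in> {x \<in> H \<times> K. ?f x = ?f a}"
          using t a by auto
      qed
      show "(\<lambda>x. inv h \<otimes> fst x) \<in> {x \<in> H \<times> K. ?f x = ?f a} \<rightarrow> H \<inter> K"
      proof
        fix x assume x: "x \<in> {x \<in> H \<times> K. ?f x = ?f a}"
        then obtain h' k' where x': "x = (h', k')" "h' \<in> H" "k' \<in> K" "h' \<otimes> k' = h \<otimes> k"
          using a by auto
        have "inv h \<otimes> h' = k \<otimes> inv k'"
          using x' a by (metis H.mem_carrier K.mem_carrier inv_closed inv_solve_left inv_solve_right m_assoc m_closed)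
        then show "inv h \<otimes> fst x \<in> H \<inter> K"
          using x' a by (metis H.m_closed H.m_inv_closed IntI K.m_closed K.m_inv_closed fst_conv)
      qed
      show "inv h \<otimes> fst (h \<otimes> t, inv t \<otimes> k) = t" if "t \<in> H \<inter> K" for t
        using that a by (simp add: H.mem_carrier m_assoc[symmetric])
      show "(h \<otimes> (inv h \<otimes> fst x), inv (inv h \<otimes> fst x) \<otimes> k) = x"
        if xx: "x \<in> {x \<in> H \<times> K. ?f x = ?f a}" for x
      proof -
        obtain h' k' where x': "x = (h', k')" "h' \<in> H" "k' \<in> K" "h' \<otimes> k' = h \<otimes> k"
          using a xx by auto
        have c: "h \<in> carrier G" "k \<in> carrier G" "h' \<in> carrier G" "k' \<in> carrier G"
          using a x' by auto
        have "inv (inv h \<otimes> h') \<otimes> k = inv h' \<otimes> (h' \<otimes> k')"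
          using c by (simp add: x'(4) inv_mult_group m_assoc)
        then show ?thesis
          using c by (simp add: x'(1) m_assoc[symmetric])
      qed
    qed
    then show ?thesis by (simp add: bij_betw_same_card)
  qed
  have "H <#> K = ?f ` (H \<times> K)"
    by (auto simp: set_mult_def)
  then show ?thesis
    using card_eq_card_image_times_fibre[of "H \<times> K" ?f, OF _ fib] fin
    by (simp add: card_cartesian_product)
qed

lemma (in group_hom) card_image_times_card_kernel:
  assumes K: "subgroup K G" and fin: "finite K"
  shows "card K = card (h ` K) * card (K \<inter> kernel G H h)"
proof (rule card_eq_card_image_times_fibre[OF fin])
  interpret K: subgroup K G by fact
  fix a assume a: "a \<in> K"
  have "bij_betw (\<lambda>t. a \<otimes> t) (K \<inter> kernel G H h) {x \<in> K. h x = h a}"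
  proof (rule bij_betwI[where g = "\<lambda>x. inv a \<otimes> x"])
    show "(\<lambda>t. a \<otimes> t) \<in> K \<inter> kernel G H h \<rightarrow> {x \<in> K. h x = h a}"
      using a by (auto simp: kernel_def)
    show "(\<lambda>x. inv a \<otimes> x) \<in> {x \<in> K. h x = h a} \<rightarrow> K \<inter> kernel G H h"
      using a by (auto simp: kernel_def)
    show "inv a \<otimes> (a \<otimes> t) = t" if "t \<in> K \<inter> kernel G H h" for t
      using a that by (simp add: K.mem_carrier G.m_assoc[symmetric])
    show "a \<otimes> (inv a \<otimes> t) = t" if "t \<in> {x \<in> K. h x = h a}" for t
      using a that by (simp add: K.mem_carrier G.m_assoc[symmetric])
  qed
  then show "card {x \<in> K. h x = h a} = card (K \<inter> kernel G H h)"
    by (simp add: bij_betw_same_card)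
qed

section \<open>Actions of groups of prime power order\<close>

text \<open>The permutations of \<open>E\<close> in a \<open>group_action\<close> are extensional functions, whence the restriction
  to \<open>E\<close>.\<close>

lemma (in group) group_action_restrictI:
  assumes "\<And>g x. g \<in> carrier G \<Longrightarrow> x \<in> E \<Longrightarrow> f g x \<in> E"
    and "\<And>x. x \<in> E \<Longrightarrow> f \<one> x = x"
    and "\<And>g h x. g \<in> carrier G \<Longrightarrow> h \<in> carrier G \<Longrightarrow> x \<in> E \<Longrightarrow> f (g \<otimes> h) x = f g (f h x)"
  shows "group_action G E (\<lambda>g. \<lambda>x\<in>E. f g x)"
proof -
  have bij: "bij_betw (f g) E E" if g: "g \<in> carrier G" for g
  proof (rule bij_betwI[where g = "f (inv g)"])
    show "f (inv g) (f g x) = x" if "x \<in> E" for x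
      using assms(2)[OF that] assms(3)[of "inv g" g x] g that by simp
    show "f g (f (inv g) x) = x" if "x \<in> E" for x
      using assms(2)[OF that] assms(3)[of g "inv g" x] g that by simp
  qed (use assms(1) g in auto)
  have "(\<lambda>g. \<lambda>x\<in>E. f g x) \<in> hom G (BijGroup E)"
  proof (rule homI)
    show "(\<lambda>x\<in>E. f g x) \<in> carrier (BijGroup E)" if "g \<in> carrier G" for g
      using bij[OF that] by (simp add: BijGroup_def Bij_def)
    show "(\<lambda>x\<in>E. f (g \<otimes> k) x) = (\<lambda>x\<in>E. f g x) \<otimes>\<^bsub>BijGroup E\<^esub> (\<lambda>x\<in>E. f k x)"
      if "g \<in> carrier G" "k \<in> carrier G" for g k
      using bij[OF that(1)] bij[OF that(2)] that assms(1,3)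
      by (auto simp: BijGroup_def Bij_def compose_def fun_eq_iff)
  qed
  then show ?thesis
    by (simp add: group_action_def group_hom_def group_hom_axioms_def group_BijGroup group_axioms)
qed

text \<open>Orbits of a \<open>p\<close>-group have \<open>p\<close>-power length, so those that are not single fixed points
  contribute \<open>0\<close> modulo \<open>p\<close>.\<close>

lemma (in group_action) card_fixed_points_cong:
  assumes p: "prime p" and ord: "card (carrier G) = p ^ n" and fin: "finite E"
  shows "[card {x \<in> E. \<forall>g\<in>carrier G. \<phi> g x = x} = card E] (mod p)"
proof -
  let ?F = "{x \<in> E. \<forall>g\<in>carrier G. \<phi> g x = x}"
  have orb: "[(\<Sum>x\<in>R. if x \<in> ?F then 1 else 0) = (\<Sum>x\<in>R. 1)] (mod p)"
    if R: "R \<in> orbits G E \<phi>" for R :: "'c set"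
  proof -
    obtain x where x: "x \<in> E" "R = orbit G \<phi> x" using R by (auto simp: orbits_def)
    have RE: "R \<subseteq> E" using orbits_coverture R by blast
    have "card R dvd p ^ n"
      using orbit_stabilizer_theorem[OF x(1)] ord x(2) by (metis dvd_triv_left order_def)
    then obtain i where i: "card R = p ^ i"
      using p by (metis divides_primepow_nat)
    show ?thesis
    proof (cases "i = 0")
      case True
      then obtain y where "R = {y}" using i by (metis card_1_singletonE power_0)
      then have y: "R = {x}" using orbit_refl[OF x(1)] x(2) by auto
      then have "x \<in> ?F" using x by (auto simp: orbit_def)
      then show ?thesis using y by simp
    next
      case False
      have "y \<notin> ?F" if y: "y \<in> R" for y
      proof
        assume yF: "y \<in> ?F"
        have yE: "y \<in> E" using y RE by auto
        have one: "orbit G \<phi> y = {y}"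
          using yF orbit_refl[OF yE] by (auto simp: orbit_def)
        have "R \<subseteq> orbit G \<phi> y"
        proof
          fix z assume z: "z \<in> R"
          have "x \<in> orbit G \<phi> y" using orbit_sym[OF x(1) yE] y x(2) by simp
          then show "z \<in> orbit G \<phi> y"
            using orbit_trans[OF yE x(1), of z] z x(2) RE by auto
        qed
        then have "R = {y}" using one y by auto
        then have "p ^ i = 1" using i by simp
        then show False using False p prime_gt_1_nat[OF p] by simp
      qed
      moreover have "[0 = card R] (mod p)"
        using False by (simp add: i cong_0_iff cong_sym_eq[of 0])
      ultimately show ?thesis by (simp add: sum.neutral del: mem_Collect_eq)
    qed
  qed
  have "card ?F = (\<Sum>x\<in>E. if x \<in> ?F then 1 else 0)"
    using fin by (simp add: sum.If_cases Int_def)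
  also have "\<dots> = (\<Sum>R\<in>orbits G E \<phi>. \<Sum>x\<in>R. if x \<in> ?F then 1 else 0)"
    by (rule disjoint_sum[OF fin, symmetric])
  also have "[\<dots> = (\<Sum>R\<in>orbits G E \<phi>. \<Sum>x\<in>R. 1)] (mod p)"
    using orb by (rule cong_sum)
  also have "(\<Sum>R\<in>orbits G E \<phi>. \<Sum>x\<in>R. 1) = (\<Sum>x\<in>E. 1::nat)"
    by (rule disjoint_sum[OF fin])
  also have "\<dots> = card E" by simp
  finally show ?thesis .
qed

section \<open>Subgroups of prime power order\<close>

lemma (in group) subgroup_nontrivial:
  assumes P: "subgroup P G" and "card P \<noteq> 1"
  obtains x where "x \<in> P" "x \<noteq> \<one>"
proof -
  have "P \<noteq> {\<one>}" using assms(2) by auto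
  then show thesis using that subgroup.one_closed[OF P] by blast
qed

lemma (in group) conjugate_subgroup:
  assumes S: "subgroup S G" and g: "g \<in> carrier G"
  shows "subgroup ((\<lambda>x. g \<otimes> x \<otimes> inv g) ` S) G"
    and "card ((\<lambda>x. g \<otimes> x \<otimes> inv g) ` S) = card S"
proof -
  have "g <# S #> inv g = (\<lambda>x. g \<otimes> x \<otimes> inv g) ` S"
    by (auto simp: l_coset_def r_coset_def)
  then show "subgroup ((\<lambda>x. g \<otimes> x \<otimes> inv g) ` S) G"
    using subgroup_conjugation_is_surj2[OF g S] by simp
  have "inj_on (\<lambda>x. g \<otimes> x \<otimes> inv g) S"
    using subgroup.subset[OF S] g by (auto intro!: inj_onI conjugation_is_inj[OF g])
  then show "card ((\<lambda>x. g \<otimes> x \<otimes> inv g) ` S) = card S"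
    by (rule card_image)
qed

lemma (in group) in_normalizer_iff:
  assumes K: "subgroup K G" and fin: "finite K"
  shows "g \<in> normalizer G K \<longleftrightarrow> g \<in> carrier G \<and> (\<forall>k\<in>K. g \<otimes> k \<otimes> inv g \<in> K)"
proof -
  have "g <# K #> inv g = (\<lambda>x. g \<otimes> x \<otimes> inv g) ` K" for g
    by (auto simp: l_coset_def r_coset_def)
  then have "g \<in> normalizer G K \<longleftrightarrow> g \<in> carrier G \<and> (\<lambda>x. g \<otimes> x \<otimes> inv g) ` K = K"
    using subgroup.subset[OF K] by (simp add: normalizer_def stabilizer_def)
  also have "\<dots> \<longleftrightarrow> g \<in> carrier G \<and> (\<lambda>x. g \<otimes> x \<otimes> inv g) ` K \<subseteq> K"
    using conjugate_subgroup(2)[OF K, of g] card_subset_eq[OF fin, of "(\<lambda>x. g \<otimes> x \<otimes> inv g) ` K"] by auto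
  finally show ?thesis by blast
qed

lemma (in group) card_subgroup_dvd:
  assumes "subgroup K G" "subgroup L G" "K \<subseteq> L"
  shows "card K dvd card L"
proof -
  have "card (rcosets\<^bsub>G\<lparr>carrier := L\<rparr>\<^esub> K) * card K = card L"
    using group.lagrange[OF subgroup_imp_group[OF assms(2)] subgroup_incl[OF assms]]
    by (simp add: order_def)
  then show ?thesis by (metis dvd_triv_right)
qed

text \<open>A \<open>p\<close>-group acting on the cosets of a subgroup of index prime to \<open>p\<close> fixes one of them.\<close>

lemma (in group) p_subgroup_conjugate_into:
  assumes fin: "finite (carrier G)" and p: "prime p"
    and S: "subgroup S G" and ind: "card (carrier G) = card S * m" "\<not> p dvd m"
    and P: "subgroup P G" "card P = p ^ n"
  shows "\<exists>g\<in>carrier G. \<forall>x\<in>P. g \<otimes> x \<otimes> inv g \<in> S"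
proof -
  interpret S: subgroup S G by fact
  interpret P: subgroup P G by fact
  interpret GP: group "G\<lparr>carrier := P\<rparr>" using subgroup_imp_group[OF P(1)] .
  let ?E = "rcosets S"
  let ?f = "\<lambda>x R. R #> inv x"
  have sub: "R \<subseteq> carrier G" if "R \<in> ?E" for R
    using S.rcosets_carrier[OF group_axioms that] .
  have "group_action (G\<lparr>carrier := P\<rparr>) ?E (\<lambda>x. \<lambda>R\<in>?E. ?f x R)"
  proof (rule GP.group_action_restrictI)
    show "?f x R \<in> ?E" if "x \<in> carrier (G\<lparr>carrier := P\<rparr>)" "R \<in> ?E" for x R
      using that by (auto simp: RCOSETS_def coset_mult_assoc S.subset)
    show "?f \<one>\<^bsub>G\<lparr>carrier := P\<rparr>\<^esub> R = R" if "R \<in> ?E" for R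
      using sub[OF that] by simp
    show "?f (x \<otimes>\<^bsub>G\<lparr>carrier := P\<rparr>\<^esub> y) R = ?f x (?f y R)"
      if "x \<in> carrier (G\<lparr>carrier := P\<rparr>)" "y \<in> carrier (G\<lparr>carrier := P\<rparr>)" "R \<in> ?E" for x y R
      using that sub[OF that(3)] by (simp add: coset_mult_assoc inv_mult_group)
  qed
  then interpret act: group_action "G\<lparr>carrier := P\<rparr>" ?E "\<lambda>x. \<lambda>R\<in>?E. ?f x R" .
  have finE: "finite ?E"
    using rcosets_subset_PowG[OF S] fin by (meson finite_Pow_iff finite_subset)
  have "card ?E * card S = card S * m"
    using lagrange[OF S] ind(1) by (simp add: order_def)
  moreover have "card S > 0"
    using S.one_closed finite_subset[OF S.subset fin] card_gt_0_iff[of S] by blast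
  ultimately have "card ?E = m" by simp
  then have "[card {R \<in> ?E. \<forall>x\<in>P. ?f x R = R} = m] (mod p)"
    using act.card_fixed_points_cong[OF p _ finE, of n] P(2)
    by (simp add: restrict_def cong: conj_cong)
  then have "\<not> p dvd card {R \<in> ?E. \<forall>x\<in>P. ?f x R = R}"
    using ind(2) cong_dvd_iff by blast
  then have "{R \<in> ?E. \<forall>x\<in>P. ?f x R = R} \<noteq> {}" by (metis card.empty dvd_0_right)
  then obtain g where g: "g \<in> carrier G" "\<forall>x\<in>P. (S #> g) #> inv x = S #> g"
    by (auto simp: RCOSETS_def)
  have "g \<otimes> x \<otimes> inv g \<in> S" if x: "x \<in> P" for x
  proof -
    have "(S #> g) #> inv (inv x) = S #> g"
      using g(2) P.m_inv_closed[OF x] by blast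
    then have "S #> (g \<otimes> x) = S #> g"
      using g(1) x by (simp add: coset_mult_assoc S.subset)
    then have "g \<otimes> x \<in> S #> g"
      using rcos_self[OF _ S, of "g \<otimes> x"] g(1) x by simp
    then show ?thesis
      using S.rcos_module_imp[OF group_axioms g(1)] by simp
  qed
  then show ?thesis using g(1) by blast
qed

text \<open>Here \<open>Q\<close> acts on \<open>A\<close> by conjugation. The number of fixed points is divisible by \<open>p\<close>, and \<open>\<one>\<close> is
  one of them.\<close>

lemma (in group) p_group_fixes_element:
  assumes p: "prime p" and A: "subgroup A G" "card A = p ^ a" "A \<noteq> {\<one>}"
    and Q: "subgroup Q G" "card Q = p ^ b"
    and conj: "\<And>x y. x \<in> Q \<Longrightarrow> y \<in> A \<Longrightarrow> x \<otimes> y \<otimes> inv x \<in> A"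
  shows "\<exists>y\<in>A. y \<noteq> \<one> \<and> (\<forall>x\<in>Q. x \<otimes> y = y \<otimes> x)"
proof -
  interpret A: subgroup A G by fact
  interpret Q: subgroup Q G by fact
  interpret GQ: group "G\<lparr>carrier := Q\<rparr>" using subgroup_imp_group[OF Q(1)] .
  let ?f = "\<lambda>x y. x \<otimes> y \<otimes> inv x"
  have finA: "finite A"
    using A(2) prime_gt_0_nat[OF p] by (intro card_ge_0_finite) simp
  have "group_action (G\<lparr>carrier := Q\<rparr>) A (\<lambda>x. \<lambda>y\<in>A. ?f x y)"
    by (rule GQ.group_action_restrictI) (use conj in \<open>auto simp: inv_mult_group m_assoc\<close>)
  then interpret act: group_action "G\<lparr>carrier := Q\<rparr>" A "\<lambda>x. \<lambda>y\<in>A. ?f x y" .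
  define F where "F = {y \<in> A. \<forall>x\<in>Q. ?f x y = y}"
  have "a \<noteq> 0"
  proof
    assume "a = 0"
    then obtain z where "A = {z}" using A(2) by (metis card_1_singletonE power_0)
    then show False using A(3) A.one_closed by auto
  qed
  then have "p dvd card A" using A(2) by simp
  moreover have "[card F = card A] (mod p)"
    using act.card_fixed_points_cong[OF p _ finA, of b] Q(2)
    by (simp add: F_def restrict_def cong: conj_cong)
  ultimately have "p dvd card F" using cong_dvd_iff by blast
  then have "F \<noteq> {\<one>}"
    using prime_gt_1_nat[OF p] by auto
  moreover have "\<one> \<in> F" by (simp add: F_def)
  ultimately obtain y where y: "y \<in> F" "y \<noteq> \<one>" by blast
  have "x \<otimes> y = y \<otimes> x" if x: "x \<in> Q" for x
  proof -
    have "x \<otimes> y \<otimes> inv x = y" using y(1) x by (simp add: F_def)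
    then have "(x \<otimes> y \<otimes> inv x) \<otimes> x = y \<otimes> x" by simp
    then show ?thesis using x y(1) by (simp add: F_def m_assoc)
  qed
  then show ?thesis using y by (auto simp: F_def)
qed

lemma (in group) cauchy:
  assumes H: "subgroup H G" "finite H" and p: "prime p" "p dvd card H"
  shows "\<exists>P. subgroup P G \<and> P \<subseteq> H \<and> card P = p"
proof -
  obtain m where m: "card H = p * m" using p(2) by (rule dvdE)
  have "order (G\<lparr>carrier := H\<rparr>) = p ^ 1 * m" by (simp add: order_def m)
  moreover have "finite (carrier (G\<lparr>carrier := H\<rparr>))" using H(2) by simp
  ultimately have "\<exists>P. subgroup P (G\<lparr>carrier := H\<rparr>) \<and> card P = p ^ 1"
    by (rule sylow_thm[OF p(1) subgroup_imp_group[OF H(1)]])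
  then obtain P where P: "subgroup P (G\<lparr>carrier := H\<rparr>)" "card P = p"
    by (metis power_one_right)
  moreover have "subgroup P G" "P \<subseteq> H"
    using incl_subgroup[OF H(1) P(1)] subgroup.subset[OF P(1)] by auto
  ultimately show ?thesis by blast
qed

lemma (in group) cauchy_element:
  assumes H: "subgroup H G" "finite H" and p: "prime p" "p dvd card H"
  shows "\<exists>x\<in>H. x \<noteq> \<one> \<and> x [^] p = \<one>"
proof -
  obtain P where P: "subgroup P G" "P \<subseteq> H" "card P = p" using cauchy[OF H p] by auto
  then obtain x where x: "x \<in> P" "x \<noteq> \<one>"
    using subgroup_nontrivial[OF P(1)] prime_gt_1_nat[OF p(1)] by auto
  have "x \<in> carrier (G\<lparr>carrier := P\<rparr>)" using x(1) by simp
  from group.pow_order_eq_1[OF subgroup_imp_group[OF P(1)] this]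
  have "x [^]\<^bsub>G\<lparr>carrier := P\<rparr>\<^esub> p = \<one>" using P(3) by (simp add: order_def)
  then have "x [^] p = \<one>" by (simp add: nat_pow_def)
  then show ?thesis using x P(2) by blast
qed

lemma (in group) sylow_exists:
  assumes H: "subgroup H G" "finite H" and p: "prime p"
  shows "\<exists>P n m. subgroup P G \<and> P \<subseteq> H \<and> card P = p ^ n \<and> card H = card P * m \<and> \<not> p dvd m"
proof -
  have "card H > 0" using subgroup.one_closed[OF H(1)] H(2) card_gt_0_iff[of H] by blast
  then obtain n m where "\<not> p dvd m" "card H = m * p ^ n"
    using prime_power_canonical[OF p] by blast
  then have nm: "card H = p ^ n * m" "\<not> p dvd m" by (simp_all add: mult.commute)
  have "order (G\<lparr>carrier := H\<rparr>) = p ^ n * m" by (simp add: order_def nm)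
  moreover have "finite (carrier (G\<lparr>carrier := H\<rparr>))" using H(2) by simp
  ultimately have "\<exists>P. subgroup P (G\<lparr>carrier := H\<rparr>) \<and> card P = p ^ n"
    by (rule sylow_thm[OF p subgroup_imp_group[OF H(1)]])
  then obtain P where P: "subgroup P (G\<lparr>carrier := H\<rparr>)" "card P = p ^ n"
    by blast
  have "subgroup P G" "P \<subseteq> H"
    using incl_subgroup[OF H(1) P(1)] subgroup.subset[OF P(1)] by auto
  then show ?thesis using P(2) nm by metis
qed

lemma (in group) card_prime_power_if_exponent_prime:
  assumes A: "subgroup A G" "finite A" and r: "prime r"
    and exp: "\<And>x. x \<in> A \<Longrightarrow> x [^] r = \<one>"
  shows "\<exists>n. card A = r ^ n"
proof -
  have A0: "card A \<noteq> 0" using subgroup.one_closed[OF A(1)] A(2) by auto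
  have "q = r" if q: "prime q" "q dvd card A" for q
  proof -
    obtain x where x: "x \<in> A" "x \<noteq> \<one>" "x [^] q = \<one>" using cauchy_element[OF A q] by auto
    have xG: "x \<in> carrier G" using subgroup.mem_carrier[OF A(1) x(1)] .
    have "ord x dvd r" "ord x dvd q" using exp[OF x(1)] x(3) pow_eq_id[OF xG] by blast+
    moreover have "ord x \<noteq> 1" using ord_eq_1[OF xG] x(2) by simp
    ultimately show ?thesis using r q(1) prime_nat_iff by metis
  qed
  note only_r = this
  have "card A > 0" using A0 by simp
  then obtain n m where nm: "\<not> r dvd m" "card A = m * r ^ n"
    using prime_power_canonical[OF r] by blast
  have "m = 1"
  proof (rule ccontr)
    assume "m \<noteq> 1"
    then obtain q where "prime q" "q dvd m" using prime_factor_nat by blast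
    then show False using only_r[of q] nm by auto
  qed
  then show ?thesis using nm(2) by auto
qed

section \<open>Quotients and preimages\<close>

text \<open>The quotient by a normal subgroup, carried by a set of coset representatives: the carrier
  then has the same type as the one of the given group, so that an induction over finite groups of
  a fixed type can pass to quotients.\<close>

lemma (in group) quotient_on_representatives:
  assumes N: "N \<lhd> G"
  obtains Q :: "('a, 'b) monoid_scheme" and h
  where "group_hom G Q h" "h ` carrier G = carrier Q" "kernel G Q h = N"
proof -
  interpret N: normal N G by fact
  define h where "h x = (SOME y. y \<in> N #> x)" for x
  have h_in: "h x \<in> N #> x" if "x \<in> carrier G" for x
    unfolding h_def using rcos_self[OF that N.subgroup_axioms] by (rule someI)
  have hG: "h x \<in> carrier G" if "x \<in> carrier G" for x
    using h_in[OF that] r_coset_subset_G[OF N.subset that] by blast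
  have coset_h: "N #> h x = N #> x" if "x \<in> carrier G" for x
    using repr_independence[OF h_in[OF that] that N.subgroup_axioms] by simp
  define Q' where "Q' = G\<lparr>mult := \<lambda>a b. h (a \<otimes> b)\<rparr>"
  have hom': "h \<in> hom G Q'"
  proof (rule homI)
    show "h x \<in> carrier Q'" if "x \<in> carrier G" for x
      using hG[OF that] by (simp add: Q'_def)
    \<comment> \<open>\<open>h\<close> depends on its argument only through the coset, and \<open>h x\<close> lies in the coset of \<open>x\<close>.\<close>
    show "h (x \<otimes> y) = h x \<otimes>\<^bsub>Q'\<^esub> h y" if "x \<in> carrier G" "y \<in> carrier G" for x y
    proof -
      have "N #> (h x \<otimes> h y) = N #> (x \<otimes> y)"
        using that hG coset_h N.rcos_sum by metis
      then show ?thesis by (simp add: Q'_def h_def)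
    qed
  qed
  define Q where "Q = Q'\<lparr>carrier := h ` carrier G, one := h \<one>\<rparr>"
  have "group Q" unfolding Q_def by (rule hom_imp_img_group[OF hom'])
  moreover have "h \<in> hom G Q" using hom' by (auto simp: hom_def Q_def)
  ultimately have "group_hom G Q h"
    by (simp add: group_hom_def group_hom_axioms_def group_axioms)
  moreover have "h ` carrier G = carrier Q" by (simp add: Q_def)
  moreover have "kernel G Q h = N"
  proof -
    have "h x = h \<one> \<longleftrightarrow> x \<in> N" if x: "x \<in> carrier G" for x
    proof
      assume "h x = h \<one>"
      then have "N #> x = N #> \<one>" using coset_h[OF x] coset_h[OF one_closed] by simp
      then show "x \<in> N" using rcos_self[OF x N.subgroup_axioms] N.subset by simp
    next
      assume "x \<in> N"
      then have "N #> x = N #> \<one>" using N.rcos_const[OF group_axioms] N.subset by simp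
      then show "h x = h \<one>" by (simp add: h_def)
    qed
    then show ?thesis using N.subset by (auto simp: kernel_def Q_def)
  qed
  ultimately show thesis by (rule that)
qed

lemma (in group_hom) subgroup_preimage:
  assumes L: "subgroup L H"
  shows "subgroup {x \<in> carrier G. h x \<in> L} G"
proof -
  interpret L: subgroup L H by fact
  show ?thesis by unfold_locales (auto simp: hom_mult)
qed

lemma (in group_hom) normal_preimage:
  assumes L: "L \<lhd> H"
  shows "{x \<in> carrier G. h x \<in> L} \<lhd> G"
  using G.normal_invI[OF subgroup_preimage[OF normal_imp_subgroup[OF L]]] normal.inv_op_closed2[OF L]
  by auto

lemma (in group_hom) card_preimage:
  assumes L: "subgroup L H" and surj: "h ` carrier G = carrier H" and fin: "finite (carrier G)"
  shows "card {x \<in> carrier G. h x \<in> L} = card L * card (kernel G H h)"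
proof -
  let ?P = "{x \<in> carrier G. h x \<in> L}"
  have "h ` ?P = L" using subgroup.subset[OF L] surj unfolding surj[symmetric] by auto
  moreover have "?P \<inter> kernel G H h = kernel G H h"
    using subgroup.one_closed[OF L] by (auto simp: kernel_def)
  ultimately show ?thesis
    using card_image_times_card_kernel[OF subgroup_preimage[OF L]] fin by simp
qed

section \<open>Hall subgroups of solvable groups\<close>

lemma (in group) conjugate_pow:
  assumes "g \<in> carrier G" "x \<in> carrier G"
  shows "(g \<otimes> x \<otimes> inv g) [^] (n::nat) = g \<otimes> x [^] n \<otimes> inv g"
proof (induction n)
  case (Suc n)
  have "inv g \<otimes> (g \<otimes> (x \<otimes> inv g)) = x \<otimes> inv g"
    using assms by (simp add: m_assoc[symmetric])
  then show ?case using assms Suc by (simp add: m_assoc)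
qed (use assms in simp)

text \<open>In the last nontrivial term of the derived series, which is abelian and normal, the elements
  \<open>x\<close> with \<open>x\<^sup>r = 1\<close> form such a subgroup for each prime divisor \<open>r\<close> of its order.\<close>

lemma (in group) solvable_imp_normal_abelian_p_subgroup:
  assumes fin: "finite (carrier G)" and solv: "solvable G" and nontriv: "carrier G \<noteq> {\<one>}"
  shows "\<exists>A r n. A \<lhd> G \<and> A \<noteq> {\<one>} \<and> prime r \<and> card A = r ^ n \<and>
    (\<forall>x\<in>A. \<forall>y\<in>A. x \<otimes> y = y \<otimes> x)"
proof -
  let ?D = "\<lambda>i. (derived G ^^ i) (carrier G)"
  obtain n where "?D n = {\<one>}" using solvable_iff_trivial_derived_seq solv by auto
  then obtain k where k: "?D k \<noteq> {\<one>}" "?D (Suc k) = {\<one>}"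
    using nontriv dec_induct[of 0 n "\<lambda>i. ?D i \<noteq> {\<one>}"] by (auto simp: less_eq_nat.simps(1))
  define B where "B = ?D k"
  have norm: "?D i \<lhd> G" for i
    by (induction i) (simp_all add: normal_self derived_is_normal)
  then have B: "B \<lhd> G" by (simp add: B_def)
  interpret B: normal B G by fact
  have comm: "x \<otimes> y = y \<otimes> x" if "x \<in> B" "y \<in> B" for x y
  proof -
    have "x \<otimes> y \<otimes> inv x \<otimes> inv y \<in> derived G B"
      unfolding derived_def using that by (intro generate.incl) blast
    then have "x \<otimes> y \<otimes> inv x \<otimes> inv y = \<one>" using k(2) by (simp add: B_def)
    then have "x \<otimes> y \<otimes> inv (y \<otimes> x) = \<one>"
      using that by (simp add: inv_mult_group m_assoc)
    then show ?thesis using that by (metis B.mem_carrier inv_equality inv_inv m_closed inv_closed)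
  qed
  have finB: "finite B" using finite_subset[OF B.subset fin] .
  have "card B \<noteq> 1"
    using k(1) B.one_closed by (auto simp: B_def card_1_singleton_iff)
  then obtain r where r: "prime r" "r dvd card B" using prime_factor_nat by blast
  define A where "A = {x \<in> B. x [^] r = \<one>}"
  have sub: "subgroup A G"
  proof (rule subgroupI)
    show "A \<subseteq> carrier G" using B.subset by (auto simp: A_def)
    show "A \<noteq> {}" using B.one_closed nat_pow_one[of r] unfolding A_def by blast
    show "inv x \<in> A" if "x \<in> A" for x
      using that by (auto simp: A_def nat_pow_inv)
    show "x \<otimes> y \<in> A" if "x \<in> A" "y \<in> A" for x y
      using that comm by (auto simp: A_def pow_mult_distrib)
  qed
  moreover have "A \<lhd> G"
    by (rule normal_invI[OF sub]) (auto simp: A_def conjugate_pow B.inv_op_closed2)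
  moreover have "A \<noteq> {\<one>}"
    using cauchy_element[OF B.subgroup_axioms finB r] unfolding A_def by blast
  moreover have "\<exists>n. card A = r ^ n"
    by (rule card_prime_power_if_exponent_prime[OF sub _ r(1)]) (use finB in \<open>auto simp: A_def\<close>)
  moreover have "\<forall>x\<in>A. \<forall>y\<in>A. x \<otimes> y = y \<otimes> x" using comm by (simp add: A_def)
  ultimately show ?thesis using r(1) by blast
qed

lemma (in group) hall_subgroupI:
  assumes K: "subgroup K G" and fin: "finite (carrier G)"
    and "prime_factors (card K) \<subseteq> \<omega>" "card (carrier G) = card K * m" "prime_factors m \<inter> \<omega> = {}"
  shows "hall_subgroup \<omega> K G"
proof -
  have "card K > 0"
    using subgroup.one_closed[OF K] finite_subset[OF subgroup.subset[OF K] fin]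
      card_gt_0_iff[of K] by blast
  then have "card (rcosets K) = m"
    using lagrange[OF K] assms(4) by (simp add: order_def mult.commute)
  then show ?thesis using assms by (simp add: hall_subgroup_def)
qed

lemma (in group) hall_subgroupE:
  assumes "hall_subgroup \<omega> K G"
  obtains m where "subgroup K G" "prime_factors (card K) \<subseteq> \<omega>" "card (carrier G) = card K * m"
    "prime_factors m \<inter> \<omega> = {}"
  using assms lagrange[of K] that[of "card (rcosets K)"]
  by (simp add: hall_subgroup_def order_def mult.commute)

lemma (in group) card_subgroup_pos:
  assumes "subgroup K G" "finite K"
  shows "card K > 0"
  using subgroup.one_closed[OF assms(1)] assms(2) card_gt_0_iff[of K] by blast

lemma prime_factors_prime_power:
  assumes "prime (p::nat)" shows "prime_factors (p ^ n) \<subseteq> {p}"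
  using assms by (auto simp: prime_factors_dvd dest: prime_dvd_power primes_dvd_imp_eq)

lemma (in group) hall_subgroup_preimage:
  assumes Q: "group_hom G Q h" "h ` carrier G = carrier Q" and fin: "finite (carrier G)"
    and L: "hall_subgroup \<omega> L Q" and ker: "prime_factors (card (kernel G Q h)) \<subseteq> \<omega>"
  shows "hall_subgroup \<omega> {x \<in> carrier G. h x \<in> L} G"
proof -
  interpret h: group_hom G Q h by fact
  obtain m where m: "subgroup L Q" "prime_factors (card L) \<subseteq> \<omega>" "card (carrier Q) = card L * m"
    "prime_factors m \<inter> \<omega> = {}"
    using h.H.hall_subgroupE[OF L] by blast
  have "card (carrier G) = card (carrier Q) * card (kernel G Q h)"
    using h.card_preimage[OF h.H.subgroup_self Q(2) fin] by (simp add: Collect_conj_eq Q(2)[symmetric] Int_absorb2 image_subset_iff_funcset Pi_def subset_eq)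
  moreover note card = h.card_preimage[OF m(1) Q(2) fin]
  ultimately have 1: "card (carrier G) = card {x \<in> carrier G. h x \<in> L} * m"
    using m(3) by simp
  have "finite (carrier Q)" using fin Q(2) by (metis finite_imageI)
  then have "card L \<noteq> 0" using h.H.card_subgroup_pos[OF m(1)] subgroup.subset[OF m(1)] finite_subset by fastforce
  moreover have "card (kernel G Q h) \<noteq> 0"
    using card_subgroup_pos[OF h.subgroup_kernel finite_subset[OF subgroup.subset[OF h.subgroup_kernel] fin]]
    by linarith
  ultimately have "prime_factors (card {x \<in> carrier G. h x \<in> L}) \<subseteq> \<omega>"
    using card ker m(2) by (simp add: prime_factors_product)
  then show ?thesis
    using hall_subgroupI[OF h.subgroup_preimage[OF m(1)] fin _ 1 m(4)] by simp
qed

lemma (in group) solvable_subgroup_group: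
  assumes L: "subgroup L G" and solv: "solvable G"
  shows "solvable (G\<lparr>carrier := L\<rparr>)"
proof -
  interpret L: group "G\<lparr>carrier := L\<rparr>" using subgroup_imp_group[OF L] .
  have "group_hom (G\<lparr>carrier := L\<rparr>) G (\<lambda>x. x)"
    using subgroup.subset[OF L] by unfold_locales (auto simp: hom_def)
  then show ?thesis using group_hom.inj_hom_imp_solvable solv inj_on_id2 by blast
qed

text \<open>Induction on the order of \<open>G\<close>. Let \<open>A\<close> be a nontrivial normal \<open>r\<close>-subgroup. If \<open>r \<in> \<omega>\<close>, take the
  preimage of a Hall subgroup of \<open>G/A\<close>. Otherwise let \<open>M\<close> be this preimage; its index has no prime
  divisor in \<open>\<omega>\<close>, so that a Hall subgroup of \<open>M\<close> will do unless \<open>M = G\<close>. In that case \<open>G/A\<close> is an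
  \<open>\<omega>\<close>-group. If it is trivial, so is a Hall subgroup of \<open>G\<close>; if not, let \<open>T/A\<close> be a nontrivial normal
  \<open>t\<close>-subgroup of it and \<open>S\<close> a Sylow \<open>t\<close>-subgroup of \<open>T\<close>, so that \<open>T = S A\<close>. The Frattini argument gives
  \<open>G = A Y\<close> for the normalizer \<open>Y\<close> of \<open>S\<close>, whose index is thus a power of \<open>r\<close>. If \<open>Y = G\<close>, pass to
  \<open>G/S\<close>, and otherwise to \<open>Y\<close>.\<close>

theorem solvable_has_hall_subgroup:
  fixes G :: "('a, 'b) monoid_scheme"
  assumes "group G" "finite (carrier G)" "solvable G"
  shows "\<exists>K. hall_subgroup \<omega> K G"
  using assms
proof (induction "card (carrier G)" arbitrary: G rule: less_induct)
  case less
  interpret G: group G by fact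
  note fin = less.prems(2)
  have card_pos: "card S > 0" if "subgroup S G" for S
    using G.card_subgroup_pos[OF that finite_subset[OF subgroup.subset[OF that] fin]] .
  have by_quotient: "\<exists>K. hall_subgroup \<omega> K G"
    if T: "T \<lhd> G" "T \<noteq> {\<one>\<^bsub>G\<^esub>}" "prime_factors (card T) \<subseteq> \<omega>" for T
  proof -
    obtain Q :: "('a, 'b) monoid_scheme" and h
      where Q: "group_hom G Q h" "h ` carrier G = carrier Q" "kernel G Q h = T"
      using G.quotient_on_representatives[OF T(1)] by blast
    interpret h: group_hom G Q h by fact
    have card: "card (carrier G) = card (carrier Q) * card T"
      using h.card_image_times_card_kernel[OF G.subgroup_self fin] Q(2,3)
        subgroup.subset[OF normal_imp_subgroup[OF T(1)]] by (simp add: Int_absorb1)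
    have "card T \<noteq> 1"
      using T(2) subgroup.one_closed[OF normal_imp_subgroup[OF T(1)]]
      by (auto simp: card_1_singleton_iff)
    moreover have "card (carrier G) > 0" using card_pos[OF G.subgroup_self] .
    ultimately have "card (carrier Q) < card (carrier G)"
      unfolding card by (cases "card T") auto
    moreover have "finite (carrier Q)" using fin Q(2) by (metis finite_imageI)
    moreover have "solvable Q" using h.surj_hom_imp_solvable[OF Q(2) less.prems(3)] .
    ultimately obtain L where "hall_subgroup \<omega> L Q"
      using less.hyps[of Q] h.H.group_axioms by blast
    then show ?thesis
      using G.hall_subgroup_preimage[OF Q(1,2) fin] T(3) Q(3) by blast
  qed
  have by_subgroup: "\<exists>K. hall_subgroup \<omega> K G"
    if L: "subgroup L G" "L \<noteq> carrier G" "card (carrier G) = card L * m" "prime_factors m \<inter> \<omega> = {}"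
    for L m
  proof -
    have finL: "finite L" using finite_subset[OF subgroup.subset[OF L(1)] fin] .
    interpret L: group "G\<lparr>carrier := L\<rparr>" using G.subgroup_imp_group[OF L(1)] .
    have "card L < card (carrier G)"
      using L(2) subgroup.subset[OF L(1)] fin by (simp add: psubset_card_mono psubsetI)
    then have "\<exists>K. hall_subgroup \<omega> K (G\<lparr>carrier := L\<rparr>)"
      using less.hyps[of "G\<lparr>carrier := L\<rparr>"] G.solvable_subgroup_group[OF L(1) less.prems(3)]
        L.group_axioms finL by simp
    then obtain K where "hall_subgroup \<omega> K (G\<lparr>carrier := L\<rparr>)" by blast
    then obtain k where K: "subgroup K (G\<lparr>carrier := L\<rparr>)" "prime_factors (card K) \<subseteq> \<omega>"
      "card (carrier (G\<lparr>carrier := L\<rparr>)) = card K * k" "prime_factors k \<inter> \<omega> = {}"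
      by (rule L.hall_subgroupE)
    have card: "card (carrier G) = card K * (k * m)" using K(3) L(3) by simp
    then have "k * m \<noteq> 0" using card_pos[OF G.subgroup_self] by (metis mult_0_right less_irrefl)
    then have "prime_factors (k * m) \<inter> \<omega> = {}"
      using K(4) L(4) by (auto simp: prime_factors_product)
    then show ?thesis
      using G.hall_subgroupI[OF G.incl_subgroup[OF L(1) K(1)] fin K(2) card] by blast
  qed
  show ?case
  proof (cases "carrier G = {\<one>\<^bsub>G\<^esub>}")
    case True
    then have "hall_subgroup \<omega> (carrier G) G"
      by (intro G.hall_subgroupI[OF G.subgroup_self fin, of _ 1]) auto
    then show ?thesis by blast
  next
    case False
    then obtain A r n where A: "A \<lhd> G" "A \<noteq> {\<one>\<^bsub>G\<^esub>}" "prime r" "card A = r ^ n"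
      using G.solvable_imp_normal_abelian_p_subgroup[OF fin less.prems(3)] by blast
    note A_sub = normal_imp_subgroup[OF A(1)]
    show ?thesis
    proof (cases "r \<in> \<omega>")
      case True
      then show ?thesis
        using by_quotient[OF A(1,2)] prime_factors_prime_power[OF A(3), of n] A(4) by auto
    next
      case r: False
      have r_pow: "prime_factors m \<inter> \<omega> = {}" if "m dvd r ^ n" for m
        using dvd_prime_factors[OF _ that] prime_factors_prime_power[OF A(3), of n] r
          prime_gt_0_nat[OF A(3)] by auto
      obtain Q :: "('a, 'b) monoid_scheme" and h
        where Q: "group_hom G Q h" "h ` carrier G = carrier Q" "kernel G Q h = A"
        using G.quotient_on_representatives[OF A(1)] by blast
      interpret h: group_hom G Q h by fact
      have cardG: "card (carrier G) = card (carrier Q) * r ^ n"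
        using h.card_image_times_card_kernel[OF G.subgroup_self fin] Q(2,3)
          subgroup.subset[OF A_sub] A(4) by (simp add: Int_absorb1)
      have "card A \<noteq> 1"
        using A(2) subgroup.one_closed[OF A_sub] by (auto simp: card_1_singleton_iff)
      then have "r ^ n \<noteq> 1" "r ^ n > 0" using A(3,4) prime_gt_0_nat by auto
      moreover have "card (carrier G) > 0" using card_pos[OF G.subgroup_self] .
      ultimately have "card (carrier Q) < card (carrier G)"
        unfolding cardG by (cases "r ^ n") auto
      moreover have finQ: "finite (carrier Q)" using fin Q(2) by (metis finite_imageI)
      moreover have solvQ: "solvable Q" using h.surj_hom_imp_solvable[OF Q(2) less.prems(3)] .
      ultimately obtain L where "hall_subgroup \<omega> L Q"
        using less.hyps[of Q] h.H.group_axioms by blast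
      then obtain m where L: "subgroup L Q" "prime_factors (card L) \<subseteq> \<omega>"
        "card (carrier Q) = card L * m" "prime_factors m \<inter> \<omega> = {}"
        using h.H.hall_subgroupE by blast
      define M where "M = {x \<in> carrier G. h x \<in> L}"
      have M: "subgroup M G" unfolding M_def by (rule h.subgroup_preimage[OF L(1)])
      have cardM: "card M = card L * r ^ n"
        using h.card_preimage[OF L(1) Q(2) fin] Q(3) A(4) by (simp add: M_def)
      show ?thesis
      proof (cases "M = carrier G")
        case False
        then show ?thesis
          using by_subgroup[OF M _ _ L(4)] cardG cardM L(3) by simp
      next
        case True
        have "card L = card (carrier Q)"
          using cardM cardG True prime_gt_0_nat[OF A(3)] by auto
        then have Q_num: "prime_factors (card (carrier Q)) \<subseteq> \<omega>" using L(2) by simp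
        show ?thesis
        proof (cases "carrier Q = {\<one>\<^bsub>Q\<^esub>}")
          case True
          then have "card (carrier G) = card {\<one>\<^bsub>G\<^esub>} * r ^ n" using cardG by simp
          then have "hall_subgroup \<omega> {\<one>\<^bsub>G\<^esub>} G"
            using r_pow[of "r ^ n"] by (intro G.hall_subgroupI[OF G.triv_subgroup fin]) auto
          then show ?thesis by blast
        next
          case False
          then obtain B t b where B: "B \<lhd> Q" "B \<noteq> {\<one>\<^bsub>Q\<^esub>}" "prime t" "card B = t ^ b"
            using h.H.solvable_imp_normal_abelian_p_subgroup[OF finQ solvQ] by blast
          note B_sub = normal_imp_subgroup[OF B(1)]
          have "card B \<noteq> 1"
            using B(2) subgroup.one_closed[OF B_sub] by (auto simp: card_1_singleton_iff)
          then have b: "b \<noteq> 0" using B(4) by auto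
          have "t dvd card B" using B(4) b by simp
          then have "t dvd card (carrier Q)"
            using h.H.card_subgroup_dvd[OF B_sub h.H.subgroup_self subgroup.subset[OF B_sub]]
            by (rule dvd_trans)
          moreover have "card (carrier Q) \<noteq> 0"
            using h.H.card_subgroup_pos[OF h.H.subgroup_self finQ] by linarith
          ultimately have t: "t \<in> \<omega>" using Q_num B(3) by (auto simp: prime_factors_dvd)
          then have tr: "\<not> t dvd r ^ n"
            using r B(3) A(3) by (metis prime_dvd_power primes_dvd_imp_eq)
          define T where "T = {x \<in> carrier G. h x \<in> B}"
          have T_norm: "T \<lhd> G" unfolding T_def by (rule h.normal_preimage[OF B(1)])
          note T = normal_imp_subgroup[OF T_norm]
          have finT: "finite T" using finite_subset[OF subgroup.subset[OF T] fin] .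
          have cardT: "card T = t ^ b * r ^ n"
            using h.card_preimage[OF B_sub Q(2) fin] Q(3) A(4) B(4) by (simp add: T_def)
          have AT: "A \<subseteq> T"
            using Q(3) subgroup.one_closed[OF B_sub] by (auto simp: T_def kernel_def)
          obtain S s k where S: "subgroup S G" "S \<subseteq> T" "card S = t ^ s" "card T = card S * k"
            "\<not> t dvd k"
            using G.sylow_exists[OF T finT B(3)] by blast
          have "s = b"
          proof -
            have "t ^ s * k = t ^ b * r ^ n" using S(3,4) cardT by simp
            then have "k * t ^ s = r ^ n * t ^ b" by (simp only: mult.commute)
            then show ?thesis using prime_power_cancel[OF B(3)] S(5) tr by blast
          qed
          have finS: "finite S" and finA: "finite A"
            using finite_subset[OF S(2) finT] finite_subset[OF AT finT] by auto
          have "card (S \<inter> A) = 1"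
          proof -
            have SA: "subgroup (S \<inter> A) G" by (rule G.subgroups_Inter_pair[OF S(1) A_sub])
            have "card (S \<inter> A) dvd t ^ b" "card (S \<inter> A) dvd r ^ n"
              using G.card_subgroup_dvd[OF SA S(1)] G.card_subgroup_dvd[OF SA A_sub] S(3) A(4) \<open>s = b\<close>
              by auto
            moreover have "coprime (t ^ b) (r ^ n)"
              using prime_imp_coprime[OF B(3) tr] coprime_power_left_iff by blast
            ultimately show ?thesis using coprime_common_divisor_nat by blast
          qed
          then have "card (S <#>\<^bsub>G\<^esub> A) = card T"
            using G.card_set_mult_subgroups[OF S(1) A_sub finS finA] S(3) A(4) cardT \<open>s = b\<close> by simp
          moreover have "S <#>\<^bsub>G\<^esub> A \<subseteq> T"
            using S(2) AT subgroup.m_closed[OF T] by (auto simp: set_mult_def)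
          ultimately have T_eq: "S <#>\<^bsub>G\<^esub> A = T" using card_subset_eq[OF finT] by blast
          define Y where "Y = normalizer G S"
          have Y: "subgroup Y G"
            unfolding Y_def by (rule G.normalizer_imp_subgroup[OF subgroup.subset[OF S(1)]])
          note in_Y = G.in_normalizer_iff[OF S(1) finS, folded Y_def]
          have SY: "S \<subseteq> Y"
            using subgroup.subset[OF S(1)] subgroup.m_closed[OF S(1)] subgroup.m_inv_closed[OF S(1)]
            by (auto simp: in_Y)
          \<comment> \<open>The conjugate of \<open>S\<close> by \<open>g\<close> can be moved back into \<open>S\<close> by an element \<open>a = s' \<alpha>\<close> of
            \<open>T = S A\<close>. So \<open>a g\<close> normalizes \<open>S\<close>, and the factor \<open>s'\<close> may be dropped.\<close>
          have frattini: "g \<in> A <#>\<^bsub>G\<^esub> Y" if g: "g \<in> carrier G" for g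
          proof -
            let ?P = "(\<lambda>x. g \<otimes>\<^bsub>G\<^esub> x \<otimes>\<^bsub>G\<^esub> inv\<^bsub>G\<^esub> g) ` S"
            interpret T: group "G\<lparr>carrier := T\<rparr>" using G.subgroup_imp_group[OF T] .
            have "?P \<subseteq> T" using S(2) normal.inv_op_closed2[OF T_norm g] by auto
            then have P: "subgroup ?P (G\<lparr>carrier := T\<rparr>)"
              using G.subgroup_incl[OF G.conjugate_subgroup(1)[OF S(1) g] T] by simp
            have "\<exists>a\<in>carrier (G\<lparr>carrier := T\<rparr>). \<forall>x\<in>?P.
                a \<otimes>\<^bsub>G\<lparr>carrier := T\<rparr>\<^esub> x \<otimes>\<^bsub>G\<lparr>carrier := T\<rparr>\<^esub> inv\<^bsub>G\<lparr>carrier := T\<rparr>\<^esub> a \<in> S"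
              using S(3) G.conjugate_subgroup(2)[OF S(1) g]
              by (intro T.p_subgroup_conjugate_into[OF _ B(3) G.subgroup_incl[OF S(1) T S(2)] _ S(5) P])
                (simp_all add: finT S(4))
            then obtain a where a: "a \<in> T"
              "\<And>x. x \<in> S \<Longrightarrow> a \<otimes>\<^bsub>G\<^esub> (g \<otimes>\<^bsub>G\<^esub> x \<otimes>\<^bsub>G\<^esub> inv\<^bsub>G\<^esub> g) \<otimes>\<^bsub>G\<^esub> inv\<^bsub>G\<^esub> a \<in> S"
              using G.m_inv_consistent[OF T] by auto
            then obtain s' \<alpha> where a': "s' \<in> S" "\<alpha> \<in> A" "a = s' \<otimes>\<^bsub>G\<^esub> \<alpha>"
              using T_eq by (auto simp: set_mult_def)
            have c: "s' \<in> carrier G" "\<alpha> \<in> carrier G" "a \<in> carrier G"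
              using a(1) a' subgroup.subset[OF S(1)] subgroup.subset[OF A_sub] subgroup.subset[OF T] by auto
            have "a \<otimes>\<^bsub>G\<^esub> g \<in> Y"
              using a(2) c(3) g subgroup.subset[OF S(1)]
              by (auto simp: in_Y G.inv_mult_group G.m_assoc subset_eq)
            then have "inv\<^bsub>G\<^esub> s' \<otimes>\<^bsub>G\<^esub> (a \<otimes>\<^bsub>G\<^esub> g) \<in> Y"
              using subgroup.m_closed[OF Y] subgroup.m_inv_closed[OF Y] SY a'(1) by blast
            moreover have "inv\<^bsub>G\<^esub> s' \<otimes>\<^bsub>G\<^esub> (a \<otimes>\<^bsub>G\<^esub> g) = \<alpha> \<otimes>\<^bsub>G\<^esub> g"
              using c g by (simp add: a'(3) G.m_assoc G.inv_solve_left')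
            moreover have "g = inv\<^bsub>G\<^esub> \<alpha> \<otimes>\<^bsub>G\<^esub> (\<alpha> \<otimes>\<^bsub>G\<^esub> g)"
              using c g by (simp add: G.m_assoc[symmetric])
            ultimately show ?thesis
              using subgroup.m_inv_closed[OF A_sub a'(2)] unfolding set_mult_def by auto
          qed
          show ?thesis
          proof (cases "Y = carrier G")
            case True
            have "S \<lhd> G"
              by (rule G.normal_invI[OF S(1)]) (use in_Y True in blast)
            moreover have "card S \<noteq> 1" using S(3) \<open>s = b\<close> B(4) \<open>card B \<noteq> 1\<close> by metis
            then have "S \<noteq> {\<one>\<^bsub>G\<^esub>}" by auto
            moreover have "prime_factors (card S) \<subseteq> \<omega>"
              using prime_factors_prime_power[OF B(3), of s] t S(3) by auto
            ultimately show ?thesis by (rule by_quotient)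
          next
            case False
            have finY: "finite Y" using finite_subset[OF subgroup.subset[OF Y] fin] .
            have "A <#>\<^bsub>G\<^esub> Y = carrier G"
              using frattini G.setmult_subset_G[OF subgroup.subset[OF A_sub] subgroup.subset[OF Y]] by blast
            then have 1: "card (carrier G) * card (A \<inter> Y) = r ^ n * card Y"
              using G.card_set_mult_subgroups[OF A_sub Y finA finY] A(4) by simp
            obtain m where m: "card (carrier G) = card Y * m"
              using G.card_subgroup_dvd[OF Y G.subgroup_self subgroup.subset[OF Y]] by (rule dvdE)
            have "m * card (A \<inter> Y) = r ^ n"
              using 1 card_pos[OF Y] unfolding m by simp
            then have "prime_factors m \<inter> \<omega> = {}" using r_pow by (metis dvd_triv_left)
            then show ?thesis using by_subgroup[OF Y False m] by blast
          qed
        qed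
      qed
    qed
  qed
qed

section \<open>Nilpotent normal subgroups and the Fitting subgroup\<close>

lemma (in group) lower_central_subset: "lower_central G i \<subseteq> carrier G"
proof (induction i)
  case (Suc i)
  then have "(\<Union>h\<in>lower_central G i. \<Union>k\<in>carrier G. {h \<otimes> k \<otimes> inv h \<otimes> inv k}) \<subseteq> carrier G"
    by auto
  then show ?case using generate_incl by (simp add: commutator_subgroup_def)
qed simp

text \<open>Normalizers grow in a nilpotent group: some term of the lower central series is not contained
  in the proper subgroup \<open>M\<close> although the next one is, and such a term normalizes \<open>M\<close>.\<close>

lemma (in group) nilpotent_normalizer_grows:
  assumes nil: "nilpotent G" and M: "subgroup M G" "M \<noteq> carrier G"
  shows "\<exists>g\<in>carrier G. g \<notin> M \<and> (\<forall>m\<in>M. g \<otimes> m \<otimes> inv g \<in> M)"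
proof -
  interpret M: subgroup M G by fact
  let ?L = "lower_central G"
  obtain n where "?L n = {\<one>}" using nil by (auto simp: nilpotent_def)
  then have n: "?L n \<subseteq> M" using M.one_closed by auto
  have 0: "\<not> ?L 0 \<subseteq> M" using M(2) M.subset by auto
  have "\<exists>i. \<not> ?L i \<subseteq> M \<and> ?L (Suc i) \<subseteq> M"
  proof (rule ccontr)
    assume step: "\<not> (\<exists>i. \<not> ?L i \<subseteq> M \<and> ?L (Suc i) \<subseteq> M)"
    have "\<not> ?L i \<subseteq> M" for i
    proof (induction i)
      case (Suc i)
      then show ?case using step by blast
    qed (rule 0)
    then show False using n by blast
  qed
  then obtain i g where i: "?L (Suc i) \<subseteq> M" and g: "g \<in> ?L i" "g \<notin> M" by blast
  have gG: "g \<in> carrier G" using g(1) lower_central_subset by blast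
  have "g \<otimes> m \<otimes> inv g \<in> M" if m: "m \<in> M" for m
  proof -
    have "g \<otimes> m \<otimes> inv g \<otimes> inv m \<in> ?L (Suc i)"
      using g(1) M.mem_carrier[OF m]
      by (auto simp: commutator_subgroup_def intro!: generate.incl)
    then have "(g \<otimes> m \<otimes> inv g \<otimes> inv m) \<otimes> m \<in> M" using i m by blast
    then show ?thesis using gG M.mem_carrier[OF m] by (simp add: m_assoc)
  qed
  then show ?thesis using gG g(2) by blast
qed

lemma prime_power_of_dvd_mult:
  assumes "prime (q::nat)" "n dvd q ^ i * q ^ j"
  shows "\<exists>k. n = q ^ k"
  using assms by (auto simp: power_add[symmetric] divides_primepow_nat)

text \<open>Take a \<open>q\<close>-subgroup \<open>S\<close> of maximal order and let \<open>M\<close> be its normalizer. Every \<open>q\<close>-subgroup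
  of \<open>M\<close> lies in \<open>S\<close>, so whatever normalizes \<open>M\<close> normalizes \<open>S\<close>; hence \<open>M\<close> is the whole group.\<close>

lemma (in group) nilpotent_largest_p_subgroup:
  assumes fin: "finite (carrier G)" and nil: "nilpotent G" and q: "prime q"
  shows "\<exists>S n. subgroup S G \<and> card S = q ^ n \<and>
    (\<forall>T j. subgroup T G \<longrightarrow> card T = q ^ j \<longrightarrow> T \<subseteq> S)"
proof -
  let ?P = "\<lambda>S. subgroup S G \<and> (\<exists>n. card S = q ^ n)"
  have "?P {\<one>}" using triv_subgroup by (auto intro: exI[of _ 0])
  moreover have bound: "card S \<le> card (carrier G)" if "?P S" for S
    using that subgroup.subset card_mono[OF fin] by blast
  ultimately obtain S where S: "?P S" and max: "\<And>T. ?P T \<Longrightarrow> card T \<le> card S"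
    using ex_has_greatest_nat[of ?P "{\<one>}" card "Suc (card (carrier G))"] by (metis less_Suc_eq_le)
  obtain n where n: "card S = q ^ n" using S by blast
  have S_sub: "subgroup S G" using S by blast
  interpret S: subgroup S G by fact
  have finS: "finite S" using finite_subset[OF S.subset fin] .
  define M where "M = normalizer G S"
  have M: "subgroup M G"
    unfolding M_def by (rule normalizer_imp_subgroup[OF S.subset])
  note in_M = in_normalizer_iff[OF S_sub finS, folded M_def]
  have SM: "S \<subseteq> M" by (auto simp: in_M)
  interpret GM: group "G\<lparr>carrier := M\<rparr>" using subgroup_imp_group[OF M] .
  have S_norm: "S \<lhd> G\<lparr>carrier := M\<rparr>"
    by (rule GM.normal_invI[OF subgroup_incl[OF S_sub M SM]])
      (use in_M m_inv_consistent[OF M] in auto)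
  have largest: "T \<subseteq> S" if T: "subgroup T G" "card T = q ^ j" "T \<subseteq> M" for T j
  proof -
    have finT: "finite T" using finite_subset[OF subgroup.subset[OF T(1)] fin] .
    interpret ST: second_isomorphism_grp S "G\<lparr>carrier := M\<rparr>" T
      using S_norm subgroup_incl[OF T(1) M T(3)]
      by (simp add: second_isomorphism_grp_def second_isomorphism_grp_axioms_def)
    have ST: "subgroup (S <#> T) G"
      using incl_subgroup[OF M ST.normal_set_mult_subgroup] by simp
    have "card (S <#> T) dvd q ^ n * q ^ j"
      using card_set_mult_subgroups[OF S_sub T(1) finS finT] n T(2) by (metis dvd_triv_left)
    then have "card (S <#> T) \<le> card S"
      using max ST prime_power_of_dvd_mult[OF q] by blast
    moreover have "S \<subseteq> S <#> T" "T \<subseteq> S <#> T"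
      using ST.H_contained_in_set_mult ST.S_contained_in_set_mult by simp_all
    moreover have "finite (S <#> T)" using finite_subset[OF subgroup.subset[OF ST] fin] .
    ultimately show ?thesis using card_seteq by blast
  qed
  have "M = carrier G"
  proof (rule ccontr)
    assume "M \<noteq> carrier G"
    then obtain g where g: "g \<in> carrier G" "g \<notin> M" "\<And>m. m \<in> M \<Longrightarrow> g \<otimes> m \<otimes> inv g \<in> M"
      using nilpotent_normalizer_grows[OF nil M] by blast
    have "(\<lambda>x. g \<otimes> x \<otimes> inv g) ` S \<subseteq> S"
      using largest[OF conjugate_subgroup(1)[OF S_sub g(1)], of n] n
        conjugate_subgroup(2)[OF S_sub g(1)] g(3) SM by auto
    then have "g \<in> M" using g(1) by (auto simp: in_M)
    then show False using g(2) by simp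
  qed
  then have "\<forall>T j. subgroup T G \<longrightarrow> card T = q ^ j \<longrightarrow> T \<subseteq> S"
    using largest subgroup.subset by blast
  then show ?thesis using S_sub n by blast
qed

text \<open>The \<open>q\<close>-subgroup of \<open>N\<close> that contains all others is invariant under conjugation in the whole
  group.\<close>

lemma (in group) normal_nilpotent_imp_normal_p_subgroup:
  assumes fin: "finite (carrier G)" and N: "N \<lhd> G" "nilpotent (G\<lparr>carrier := N\<rparr>)"
    and q: "prime q" "q dvd card N"
  shows "\<exists>S n. S \<lhd> G \<and> S \<noteq> {\<one>} \<and> card S = q ^ n"
proof -
  interpret N: normal N G by fact
  interpret GN: group "G\<lparr>carrier := N\<rparr>" using subgroup_imp_group[OF N.subgroup_axioms] .
  have finN: "finite N" using finite_subset[OF N.subset fin] .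
  obtain S n where S: "subgroup S (G\<lparr>carrier := N\<rparr>)" "card S = q ^ n"
    and largest: "\<And>T j. subgroup T (G\<lparr>carrier := N\<rparr>) \<Longrightarrow> card T = q ^ j \<Longrightarrow> T \<subseteq> S"
    using GN.nilpotent_largest_p_subgroup[OF _ N(2) q(1)] finN by auto
  have S_sub: "subgroup S G" using incl_subgroup[OF N.subgroup_axioms S(1)] .
  have SN: "S \<subseteq> N" using subgroup.subset[OF S(1)] by simp
  have largest': "T \<subseteq> S" if "subgroup T G" "card T = q ^ j" "T \<subseteq> N" for T j
    using largest[OF subgroup_incl[OF that(1) N.subgroup_axioms that(3)] that(2)] .
  have "S \<lhd> G"
  proof (rule normal_invI[OF S_sub])
    fix g x assume g: "g \<in> carrier G" and x: "x \<in> S"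
    have "(\<lambda>x. g \<otimes> x \<otimes> inv g) ` S \<subseteq> S"
      using largest'[OF conjugate_subgroup(1)[OF S_sub g], of n] S(2)
        conjugate_subgroup(2)[OF S_sub g] SN N.inv_op_closed2[OF g] by auto
    then show "g \<otimes> x \<otimes> inv g \<in> S" using x by auto
  qed
  moreover have "S \<noteq> {\<one>}"
  proof -
    obtain P where P: "subgroup P G" "P \<subseteq> N" "card P = q"
      using cauchy[OF N.subgroup_axioms finN q] by blast
    then have "P \<subseteq> S" using largest'[OF P(1), of 1] by simp
    moreover obtain x where "x \<in> P" "x \<noteq> \<one>"
      using subgroup_nontrivial[OF P(1)] P(3) prime_gt_1_nat[OF q(1)] by auto
    ultimately show ?thesis by blast
  qed
  ultimately show ?thesis using S(2) by blast
qed

text \<open>Without a nontrivial normal \<open>q\<close>-subgroup all normal nilpotent subgroups have order prime to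
  \<open>q\<close>, and they lie in a largest normal subgroup of order prime to \<open>q\<close>.\<close>

lemma (in group) fitting_prime_imp_normal_p_subgroup:
  assumes fin: "finite (carrier G)" and q: "q \<in> prime_factors (card (fitting G))"
  shows "\<exists>S n. S \<lhd> G \<and> S \<noteq> {\<one>} \<and> card S = q ^ n"
proof (rule ccontr)
  assume none: "\<not> ?thesis"
  have q': "prime q" "q dvd card (fitting G)" using q by auto
  let ?P = "\<lambda>M. M \<lhd> G \<and> \<not> q dvd card M"
  have "?P {\<one>}" using one_is_normal q'(1) by (simp add: prime_nat_iff)
  moreover have bound: "card M \<le> card (carrier G)" if "?P M" for M
    using that subgroup.subset[OF normal_imp_subgroup] card_mono[OF fin] by blast
  ultimately obtain M where M: "?P M" and max: "\<And>N. ?P N \<Longrightarrow> card N \<le> card M"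
    using ex_has_greatest_nat[of ?P "{\<one>}" card "Suc (card (carrier G))"] by (metis less_Suc_eq_le)
  interpret M: normal M G using M by simp
  have finM: "finite M" using finite_subset[OF M.subset fin] .
  have "N \<subseteq> M" if N: "N \<lhd> G" "nilpotent (G\<lparr>carrier := N\<rparr>)" for N
  proof -
    interpret N: normal N G by fact
    have finN: "finite N" using finite_subset[OF N.subset fin] .
    have MN: "M <#> N \<lhd> G"
      by (rule normal_subgroup_set_mult_closed[OF M.normal_axioms N.normal_axioms])
    have "\<not> q dvd card N"
      using normal_nilpotent_imp_normal_p_subgroup[OF fin N q'(1)] none by blast
    then have "\<not> q dvd card (M <#> N) * card (M \<inter> N)"
      using card_set_mult_subgroups[OF M.subgroup_axioms N.subgroup_axioms finM finN] M q'(1)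
      by (simp add: prime_dvd_mult_iff)
    then have "\<not> q dvd card (M <#> N)" using dvd_mult2 by blast
    then have le: "card (M <#> N) \<le> card M" using max MN by blast
    interpret MN: second_isomorphism_grp M G N
      using N.subgroup_axioms M.normal_axioms
      by (simp add: second_isomorphism_grp_def second_isomorphism_grp_axioms_def)
    have "M <#> N = M"
      using card_seteq[OF _ MN.H_contained_in_set_mult le]
        finite_subset[OF subgroup.subset[OF normal_imp_subgroup[OF MN]] fin] by simp
    then show ?thesis using MN.S_contained_in_set_mult by simp
  qed
  then have sub: "\<Union>{N. N \<lhd> G \<and> nilpotent (G\<lparr>carrier := N\<rparr>)} \<subseteq> M" by blast
  then have "fitting G \<subseteq> M" "subgroup (fitting G) G"
    unfolding fitting_def
    using generate_subgroup_incl[OF sub M.subgroup_axioms] generate_is_subgroup[of "\<Union>{N. N \<lhd> G \<and> nilpotent (G\<lparr>carrier := N\<rparr>)}"] M.subset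
    by auto
  then have "card (fitting G) dvd card M" using card_subgroup_dvd M.subgroup_axioms by blast
  then show False using q'(2) M dvd_trans by blast
qed

section \<open>Maximal subgroups with trivial core\<close>

text \<open>The index of \<open>K\<close> in \<open>Q K\<close> is a power of \<open>q\<close> and divides the index \<open>m\<close> of \<open>K\<close>.\<close>

lemma (in group) normal_p_subgroup_contained:
  assumes fin: "finite (carrier G)" and Q: "Q \<lhd> G" "card Q = q ^ j" and q: "prime q"
    and K: "subgroup K G" "card (carrier G) = card K * m" "\<not> q dvd m"
  shows "Q \<subseteq> K"
proof -
  interpret Q: normal Q G by fact
  interpret QK: second_isomorphism_grp Q G K
    using K(1) Q.normal_axioms
    by (simp add: second_isomorphism_grp_def second_isomorphism_grp_axioms_def)
  note QK = QK.normal_set_mult_subgroup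
  have finQ: "finite Q" and finK: "finite K" and finQK: "finite (Q <#> K)"
    using finite_subset[OF _ fin] Q.subset subgroup.subset[OF K(1)] subgroup.subset[OF QK] by auto
  obtain c where c: "card (Q <#> K) = card K * c"
    using card_subgroup_dvd[OF K(1) QK QK.S_contained_in_set_mult] by (rule dvdE)
  obtain d where d: "card (carrier G) = card (Q <#> K) * d"
    using card_subgroup_dvd[OF QK subgroup_self subgroup.subset[OF QK]] by (rule dvdE)
  have posK: "card K > 0" using card_subgroup_pos[OF K(1) finK] .
  have "m = c * d" using K(2) c d posK by simp
  then have "\<not> q dvd c" using K(3) by auto
  moreover have "c * card (Q \<inter> K) = q ^ j"
    using card_set_mult_subgroups[OF Q.subgroup_axioms K(1) finQ finK] Q(2) c posK by simp
  then obtain i where i: "c = q ^ i"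
    using divides_primepow_nat[OF q] by (metis dvd_triv_left)
  ultimately have "i = 0" by (metis dvd_power neq0_conv)
  then have "card (Q <#> K) = card K" using c i by simp
  then have "K = Q <#> K" using card_subset_eq[OF finQK QK.S_contained_in_set_mult] by simp
  then show ?thesis using QK.H_contained_in_set_mult by simp
qed

text \<open>In the proof \<open>A\<close> is a normal abelian \<open>r\<close>-subgroup, which turns out to be a complement of \<open>H\<close>, and
  \<open>B\<close> is the centralizer of \<open>Q\<close> in \<open>A\<close>. Normality in \<open>G\<close> is checked on products \<open>a h\<close> with \<open>h \<in> H\<close>, where
  \<open>a\<close> acts trivially: on \<open>A \<inter> H\<close> and on \<open>B\<close> because \<open>A\<close> is abelian, and on \<open>Q\<close> if \<open>a \<in> B\<close>.\<close>

lemma (in group) core_free_maximal_subgroup: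
  assumes fin: "finite (carrier G)" and solv: "solvable G" and max: "maximal_subgroup H G"
    and triv_core: "\<forall>M. M \<lhd> G \<longrightarrow> M \<subseteq> H \<longrightarrow> M = {\<one>}"
  shows "\<exists>r n. prime r \<and> card (carrier G) = card H * r ^ n \<and>
    (\<forall>Q. Q \<lhd> G\<lparr>carrier := H\<rparr> \<longrightarrow> Q \<noteq> {\<one>} \<longrightarrow>
      (\<forall>j. card Q \<noteq> r ^ j) \<and>
      (\<forall>K. subgroup K G \<longrightarrow> Q \<subseteq> K \<longrightarrow> K \<subseteq> H \<longrightarrow> normalizer G K \<subseteq> H))"
proof -
  have core_free: "M = {\<one>}" if "M \<lhd> G" "M \<subseteq> H" for M
    using triv_core that by blast
  have H_sub: "subgroup H G" and H_ne: "H \<noteq> carrier G"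
    and H_max: "\<And>K. subgroup K G \<Longrightarrow> H \<subseteq> K \<Longrightarrow> K = H \<or> K = carrier G"
    using max by (auto simp: maximal_subgroup_def)
  interpret H: subgroup H G by fact
  have finH: "finite H" using finite_subset[OF H.subset fin] .
  have "carrier G \<noteq> {\<one>}" using H_ne H.subset H.one_closed by auto
  then obtain A r n where A: "A \<lhd> G" "A \<noteq> {\<one>}" "prime r" "card A = r ^ n"
      and "\<forall>x\<in>A. \<forall>y\<in>A. x \<otimes> y = y \<otimes> x"
    using solvable_imp_normal_abelian_p_subgroup[OF fin solv] by metis
  then have comm: "\<And>x y. x \<in> A \<Longrightarrow> y \<in> A \<Longrightarrow> x \<otimes> y = y \<otimes> x" by blast
  interpret A: normal A G by fact
  have finA: "finite A" using finite_subset[OF A.subset fin] .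
  have supplement: "\<exists>b\<in>B. \<exists>h\<in>H. g = b \<otimes> h"
    if B: "B \<lhd> G" "B \<noteq> {\<one>}" and g: "g \<in> carrier G" for B g
  proof -
    interpret BH: second_isomorphism_grp B G H
      using B(1) H_sub by (simp add: second_isomorphism_grp_def second_isomorphism_grp_axioms_def)
    have "B <#> H \<noteq> H" using core_free[OF B(1)] B(2) BH.H_contained_in_set_mult by auto
    then have "B <#> H = carrier G"
      using H_max[OF BH.normal_set_mult_subgroup BH.S_contained_in_set_mult] by blast
    then show ?thesis using g unfolding set_mult_def by blast
  qed
  have conj_A: "(a \<otimes> h) \<otimes> x \<otimes> inv (a \<otimes> h) = h \<otimes> x \<otimes> inv h"
    if "a \<in> carrier G" "h \<in> carrier G" "x \<in> carrier G"
      and *: "a \<otimes> (h \<otimes> x \<otimes> inv h) = (h \<otimes> x \<otimes> inv h) \<otimes> a" for a h x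
  proof -
    have "(a \<otimes> h) \<otimes> x \<otimes> inv (a \<otimes> h) = a \<otimes> (h \<otimes> x \<otimes> inv h) \<otimes> inv a"
      using that(1-3) by (simp add: inv_mult_group m_assoc)
    also have "\<dots> = h \<otimes> x \<otimes> inv h"
      unfolding * using that(1-3) by (simp add: m_assoc)
    finally show ?thesis .
  qed
  have AH: "A \<inter> H = {\<one>}"
  proof (rule core_free)
    show "A \<inter> H \<lhd> G"
    proof (rule normal_invI[OF subgroups_Inter_pair[OF A.subgroup_axioms H_sub]])
      fix g x assume g: "g \<in> carrier G" and x: "x \<in> A \<inter> H"
      obtain a h where ah: "a \<in> A" "h \<in> H" "g = a \<otimes> h"
        using supplement[OF A(1,2) g] by blast
      have "h \<otimes> x \<otimes> inv h \<in> A \<inter> H" using x ah(2) A.inv_op_closed2[of h x] by auto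
      moreover have "g \<otimes> x \<otimes> inv g = h \<otimes> x \<otimes> inv h"
        unfolding ah(3) using ah x calculation comm by (intro conj_A) auto
      ultimately show "g \<otimes> x \<otimes> inv g \<in> A \<inter> H" by simp
    qed
  qed simp
  have "A <#> H = carrier G"
    using supplement[OF A(1,2)] setmult_subset_G[OF A.subset H.subset] by (auto simp: set_mult_def)
  then have index: "card (carrier G) = card H * r ^ n"
    using card_set_mult_subgroups[OF A.subgroup_axioms H_sub finA finH] AH A(4)
    by (simp add: mult.commute)
  have "(\<forall>j. card Q \<noteq> r ^ j) \<and>
      (\<forall>K. subgroup K G \<longrightarrow> Q \<subseteq> K \<longrightarrow> K \<subseteq> H \<longrightarrow> normalizer G K \<subseteq> H)"
    if Q: "Q \<lhd> G\<lparr>carrier := H\<rparr>" "Q \<noteq> {\<one>}" for Q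
  proof -
    have Q_sub: "subgroup Q G" using incl_subgroup[OF H_sub normal_imp_subgroup[OF Q(1)]] .
    interpret Q: subgroup Q G by fact
    have QH: "Q \<subseteq> H" using subgroup.subset[OF normal_imp_subgroup[OF Q(1)]] by simp
    have Q_conj: "h \<otimes> x \<otimes> inv h \<in> Q" "inv h \<otimes> x \<otimes> h \<in> Q" if "h \<in> H" "x \<in> Q" for h x
      using normal.inv_op_closed2[OF Q(1), of h x] normal.inv_op_closed1[OF Q(1), of h x] that
        m_inv_consistent[OF H_sub that(1)] by simp_all
    define B where "B = {a \<in> A. \<forall>x\<in>Q. x \<otimes> a = a \<otimes> x}"
    have B_sub: "subgroup B G"
    proof (rule subgroupI)
      show "B \<subseteq> carrier G" using A.subset by (auto simp: B_def)
      have "\<one> \<in> B" by (simp add: B_def)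
      then show "B \<noteq> {}" by blast
      show "inv b \<in> B" if b: "b \<in> B" for b
      proof -
        have bA: "b \<in> A" using b by (simp add: B_def)
        have "x \<otimes> inv b = inv b \<otimes> x" if x: "x \<in> Q" for x
        proof -
          have "inv b \<otimes> (x \<otimes> b) \<otimes> inv b = inv b \<otimes> (b \<otimes> x) \<otimes> inv b"
            using b x by (simp add: B_def)
          moreover have "inv b \<otimes> (b \<otimes> x) = x"
            using bA x by (simp add: m_assoc[symmetric])
          moreover have "inv b \<otimes> (x \<otimes> b) \<otimes> inv b = inv b \<otimes> x"
            using bA x by (simp add: m_assoc)
          ultimately show ?thesis by simp
        qed
        then show ?thesis using bA by (simp add: B_def)
      qed
      show "b \<otimes> c \<in> B" if bc: "b \<in> B" "c \<in> B" for b c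
      proof -
        have bcA: "b \<in> A" "c \<in> A" using bc by (simp_all add: B_def)
        have "x \<otimes> (b \<otimes> c) = b \<otimes> c \<otimes> x" if x: "x \<in> Q" for x
        proof -
          have "x \<otimes> (b \<otimes> c) = (x \<otimes> b) \<otimes> c" using x bcA by (simp add: m_assoc)
          also have "\<dots> = b \<otimes> (x \<otimes> c)" using x bc bcA by (simp add: B_def m_assoc)
          also have "\<dots> = b \<otimes> c \<otimes> x" using x bc bcA by (simp add: B_def m_assoc)
          finally show ?thesis .
        qed
        then show ?thesis using bcA by (simp add: B_def)
      qed
    qed
    have B_norm: "B \<lhd> G"
    proof (rule normal_invI[OF B_sub])
      fix g b assume g: "g \<in> carrier G" and b: "b \<in> B"
      obtain a h where ah: "a \<in> A" "h \<in> H" "g = a \<otimes> h"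
        using supplement[OF A(1,2) g] by blast
      have bA: "b \<in> A" using b by (simp add: B_def)
      have c: "a \<in> carrier G" "h \<in> carrier G" "b \<in> carrier G" using ah bA by auto
      have conjA: "h \<otimes> b \<otimes> inv h \<in> A" using A.inv_op_closed2[OF c(2) bA] .
      have "x \<otimes> (h \<otimes> b \<otimes> inv h) = (h \<otimes> b \<otimes> inv h) \<otimes> x" if x: "x \<in> Q" for x
      proof -
        let ?y = "inv h \<otimes> x \<otimes> h"
        have y: "?y \<in> Q" using Q_conj(2)[OF ah(2) x] .
        have xG: "x \<in> carrier G" using x by simp
        have hh: "h \<otimes> (inv h \<otimes> z) = z" "inv h \<otimes> (h \<otimes> z) = z" if "z \<in> carrier G" for z
          using c(2) that by (simp_all add: m_assoc[symmetric])
        have "h \<otimes> (?y \<otimes> b) \<otimes> inv h = h \<otimes> (b \<otimes> ?y) \<otimes> inv h"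
          using b y by (simp add: B_def)
        then show ?thesis using c xG by (simp add: m_assoc hh)
      qed
      then have "h \<otimes> b \<otimes> inv h \<in> B" using conjA by (simp add: B_def)
      moreover have "g \<otimes> b \<otimes> inv g = h \<otimes> b \<otimes> inv h"
        unfolding ah(3) using c comm[OF ah(1) conjA] by (intro conj_A)
      ultimately show "g \<otimes> b \<otimes> inv g \<in> B" by simp
    qed
    have B_triv: "B = {\<one>}"
    proof (rule ccontr)
      assume B: "B \<noteq> {\<one>}"
      have "Q \<lhd> G"
      proof (rule normal_invI[OF Q_sub])
        fix g x assume g: "g \<in> carrier G" and x: "x \<in> Q"
        obtain b h where bh: "b \<in> B" "h \<in> H" "g = b \<otimes> h"
          using supplement[OF B_norm B g] by blast
        have hx: "h \<otimes> x \<otimes> inv h \<in> Q" using Q_conj(1)[OF bh(2) x] .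
        have "b \<in> carrier G" using bh(1) subgroup.subset[OF B_sub] by blast
        then have "g \<otimes> x \<otimes> inv g = h \<otimes> x \<otimes> inv h"
          unfolding bh(3) using bh x hx by (intro conj_A) (auto simp: B_def)
        then show "g \<otimes> x \<otimes> inv g \<in> Q" using hx by simp
      qed
      then show False using core_free QH Q(2) by blast
    qed
    have "card Q \<noteq> r ^ j" for j
    proof
      assume j: "card Q = r ^ j"
      have "\<exists>y\<in>A. y \<noteq> \<one> \<and> (\<forall>x\<in>Q. x \<otimes> y = y \<otimes> x)"
        by (rule p_group_fixes_element[OF A(3) A.subgroup_axioms A(4,2) Q_sub j])
          (simp add: A.inv_op_closed2)
      then show False using B_triv by (auto simp: B_def)
    qed
    moreover have "normalizer G K \<subseteq> H" if K: "subgroup K G" "Q \<subseteq> K" "K \<subseteq> H" for K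
    proof
      fix g assume "g \<in> normalizer G K"
      then have g: "g \<in> carrier G" "\<And>k. k \<in> K \<Longrightarrow> g \<otimes> k \<otimes> inv g \<in> K"
        using in_normalizer_iff[OF K(1) finite_subset[OF K(3) finH]] by auto
      obtain a h where ah: "a \<in> A" "h \<in> H" "g = a \<otimes> h"
        using supplement[OF A(1,2) g(1)] by blast
      have c: "a \<in> carrier G" "h \<in> carrier G" using ah by auto
      \<comment> \<open>For \<open>x \<in> Q\<close> put \<open>k = h\<inverse> x h \<in> Q \<subseteq> K\<close>. Then \<open>g k g\<inverse> = a x a\<inverse>\<close> lies in \<open>K\<close>, so the commutator of
        \<open>a\<close> and \<open>x\<close> lies in \<open>A \<inter> H\<close>.\<close>
      have "x \<otimes> a = a \<otimes> x" if x: "x \<in> Q" for x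
      proof -
        have xG: "x \<in> carrier G" using x by simp
        have hh: "h \<otimes> (inv h \<otimes> z) = z" if "z \<in> carrier G" for z
          using c(2) that by (simp add: m_assoc[symmetric])
        have "g \<otimes> (inv h \<otimes> x \<otimes> h) \<otimes> inv g \<in> K"
          using g(2) Q_conj(2)[OF ah(2) x] K(2) by blast
        then have "a \<otimes> x \<otimes> inv a \<in> H"
          using K(3) c xG by (auto simp: ah(3) inv_mult_group m_assoc hh)
        then have "a \<otimes> x \<otimes> inv a \<otimes> inv x \<in> H" using x QH by blast
        moreover have "a \<otimes> x \<otimes> inv a \<otimes> inv x \<in> A"
          using A.m_closed[OF ah(1) A.inv_op_closed2[OF xG A.m_inv_closed[OF ah(1)]]] c xG
          by (simp add: m_assoc)
        ultimately have "a \<otimes> x \<otimes> inv a \<otimes> inv x = \<one>" using AH by blast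
        then have "(a \<otimes> x \<otimes> inv a \<otimes> inv x) \<otimes> (x \<otimes> a) = x \<otimes> a" using c xG by simp
        moreover have "inv x \<otimes> (x \<otimes> a) = a" "inv a \<otimes> a = \<one>"
          using c xG by (simp_all add: m_assoc[symmetric])
        ultimately show ?thesis using c xG by (simp add: m_assoc)
      qed
      then have "a \<in> B" using ah(1) by (simp add: B_def)
      then have "a = \<one>" using B_triv by simp
      then show "g \<in> H" using ah(2,3) by simp
    qed
    ultimately show ?thesis by blast
  qed
  then show ?thesis using A(3) index by blast
qed

section \<open>Passage to the quotient by the core\<close>

lemma (in group) in_core_iff:
  assumes "subgroup H G"
  shows "x \<in> core G H \<longleftrightarrow> x \<in> carrier G \<and> (\<forall>g\<in>carrier G. g \<otimes> x \<otimes> inv g \<in> H)"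
proof -
  interpret H: subgroup H G by fact
  have *: "x \<in> inv g <# H #> g \<longleftrightarrow> g \<otimes> x \<otimes> inv g \<in> H"
    if g: "g \<in> carrier G" and x: "x \<in> carrier G" for g
  proof
    assume "x \<in> inv g <# H #> g"
    then obtain h where h: "h \<in> H" "x = inv g \<otimes> h \<otimes> g"
      by (auto simp: l_coset_def r_coset_def)
    have "g \<otimes> (inv g \<otimes> z) = z" if "z \<in> carrier G" for z
      using g that by (simp add: m_assoc[symmetric])
    then show "g \<otimes> x \<otimes> inv g \<in> H" using h g by (simp add: m_assoc)
  next
    assume h: "g \<otimes> x \<otimes> inv g \<in> H"
    have "inv g \<otimes> (g \<otimes> z) = z" if "z \<in> carrier G" for z
      using g that by (simp add: m_assoc[symmetric])
    then have "x = inv g \<otimes> (g \<otimes> x \<otimes> inv g) \<otimes> g" using g x by (simp add: m_assoc)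
    then show "x \<in> inv g <# H #> g" using h by (auto simp: l_coset_def r_coset_def)
  qed
  show ?thesis
  proof
    assume x: "x \<in> core G H"
    then have "x \<in> inv \<one> <# H #> \<one>" unfolding core_def by blast
    then have "x \<in> carrier G" by (auto simp: l_coset_def r_coset_def)
    then show "x \<in> carrier G \<and> (\<forall>g\<in>carrier G. g \<otimes> x \<otimes> inv g \<in> H)"
      using x * unfolding core_def by blast
  next
    assume "x \<in> carrier G \<and> (\<forall>g\<in>carrier G. g \<otimes> x \<otimes> inv g \<in> H)"
    then show "x \<in> core G H" unfolding core_def using * by blast
  qed
qed

lemma (in group) core_normal:
  assumes H: "subgroup H G"
  shows "core G H \<lhd> G" and "core G H \<subseteq> H"
    and "\<And>M. M \<lhd> G \<Longrightarrow> M \<subseteq> H \<Longrightarrow> M \<subseteq> core G H"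
proof -
  interpret H: subgroup H G by fact
  note mem = in_core_iff[OF H]
  have pair: "g \<otimes> (x \<otimes> y) \<otimes> inv g = (g \<otimes> x \<otimes> inv g) \<otimes> (g \<otimes> y \<otimes> inv g)"
    if "g \<in> carrier G" "x \<in> carrier G" "y \<in> carrier G" for g x y
  proof -
    have "inv g \<otimes> (g \<otimes> z) = z" if "z \<in> carrier G" for z
      using \<open>g \<in> carrier G\<close> that by (simp add: m_assoc[symmetric])
    then show ?thesis using that by (simp add: m_assoc)
  qed
  have "subgroup (core G H) G"
  proof (rule subgroupI)
    show "core G H \<subseteq> carrier G" by (auto simp: mem)
    have "\<one> \<in> core G H" by (simp add: mem)
    then show "core G H \<noteq> {}" by blast
    show "inv x \<in> core G H" if x: "x \<in> core G H" for x
    proof -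
      have "g \<otimes> inv x \<otimes> inv g = inv (g \<otimes> x \<otimes> inv g)" if "g \<in> carrier G" for g
        using that x by (simp add: mem inv_mult_group m_assoc)
      then show ?thesis using x by (simp add: mem)
    qed
    show "x \<otimes> y \<in> core G H" if "x \<in> core G H" "y \<in> core G H" for x y
      using that by (simp add: mem pair)
  qed
  then show "core G H \<lhd> G"
  proof (rule normal_invI)
    fix g x assume g: "g \<in> carrier G" and x: "x \<in> core G H"
    have "k \<otimes> (g \<otimes> x \<otimes> inv g) \<otimes> inv k = (k \<otimes> g) \<otimes> x \<otimes> inv (k \<otimes> g)" if "k \<in> carrier G" for k
      using that g x by (simp add: mem inv_mult_group m_assoc)
    then show "g \<otimes> x \<otimes> inv g \<in> core G H" using g x by (simp add: mem)
  qed
  show "core G H \<subseteq> H"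
  proof
    fix x assume "x \<in> core G H"
    then have "x \<in> carrier G" "\<one> \<otimes> x \<otimes> inv \<one> \<in> H" unfolding mem by blast+
    then show "x \<in> H" by simp
  qed
  show "M \<subseteq> core G H" if M: "M \<lhd> G" "M \<subseteq> H" for M
  proof
    fix x assume x: "x \<in> M"
    then have "x \<in> carrier G" by (rule subgroup.mem_carrier[OF normal_imp_subgroup[OF M(1)]])
    moreover have "g \<otimes> x \<otimes> inv g \<in> H" if "g \<in> carrier G" for g
      using normal.inv_op_closed2[OF M(1) that x] M(2) by blast
    ultimately show "x \<in> core G H" by (simp add: mem)
  qed
qed

theorem corollary1p2:
  fixes G :: "('a, 'b) monoid_scheme" and H :: "'a set" and \<omega> :: "nat set"
  assumes "group G" and "finite (carrier G)" and "solvable G"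
    and "maximal_subgroup H G" and "\<not> H \<lhd> G"
    and "\<omega> \<subseteq> prime_factors (card (fitting (G\<lparr>carrier := H\<rparr> Mod core G H)))"
    and "\<omega> \<noteq> {}"
  shows "\<exists>K. hall_subgroup \<omega> K G \<and> normalizer G K \<subseteq> H"
proof -
  interpret G: group G by fact
  note fin = assms(2)
  have H_sub: "subgroup H G" and H_ne: "H \<noteq> carrier G"
    and H_max: "\<And>K. subgroup K G \<Longrightarrow> H \<subseteq> K \<Longrightarrow> K = H \<or> K = carrier G"
    using assms(4) by (auto simp: maximal_subgroup_def)
  interpret H: subgroup H G by fact
  have finH: "finite H" using finite_subset[OF H.subset fin] .
  define C where "C = core G H"
  have CH: "C \<subseteq> H" and C_norm: "C \<lhd> G"
    and C_largest: "\<And>M. M \<lhd> G \<Longrightarrow> M \<subseteq> H \<Longrightarrow> M \<subseteq> C"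
    unfolding C_def using G.core_normal[OF H_sub] by blast+
  interpret C: normal C G by fact
  define \<pi> where "\<pi> = (\<lambda>x. C #>\<^bsub>G\<^esub> x)"
  interpret Q: group "G Mod C" by (rule C.factorgroup_is_group)
  interpret \<pi>: group_hom G "G Mod C" \<pi>
    unfolding \<pi>_def by unfold_locales (rule C.r_coset_hom_Mod)
  have surj: "\<pi> ` carrier G = carrier (G Mod C)"
    by (simp add: \<pi>_def carrier_FactGroup)
  have ker: "kernel G (G Mod C) \<pi> = C"
    using G.coset_join1[OF _ _ C.subgroup_axioms] C.rcos_const[OF G.group_axioms] C.subset
    by (auto simp: kernel_def \<pi>_def)
  have in_H: "x \<in> H" if x: "x \<in> carrier G" "\<pi> x \<in> \<pi> ` H" for x
  proof -
    obtain h where h: "h \<in> H" "\<pi> x = \<pi> h" using x(2) by blast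
    have "x \<in> C #>\<^bsub>G\<^esub> h"
      using G.rcos_self[OF x(1) C.subgroup_axioms] h(2) by (simp add: \<pi>_def)
    then show ?thesis using h(1) CH by (auto simp: r_coset_def)
  qed
  have finQ: "finite (carrier (G Mod C))" using fin surj by (metis finite_imageI)
  have solvQ: "solvable (G Mod C)" using \<pi>.surj_hom_imp_solvable[OF surj assms(3)] .
  have piH: "subgroup (\<pi> ` H) (G Mod C)" using \<pi>.subgroup_img_is_subgroup[OF H_sub] .
  have maxQ: "maximal_subgroup (\<pi> ` H) (G Mod C)"
    unfolding maximal_subgroup_def
  proof (intro conjI allI impI)
    show "\<pi> ` H \<noteq> carrier (G Mod C)"
    proof
      assume "\<pi> ` H = carrier (G Mod C)"
      then have "carrier G \<subseteq> H" using in_H by (auto simp: surj[symmetric])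
      then show False using H_ne H.subset by blast
    qed
    fix L assume L: "subgroup L (G Mod C)" "\<pi> ` H \<subseteq> L"
    let ?P = "{x \<in> carrier G. \<pi> x \<in> L}"
    have "H \<subseteq> ?P" using L(2) by auto
    then have "?P = H \<or> ?P = carrier G" using H_max[OF \<pi>.subgroup_preimage[OF L(1)]] by blast
    moreover have "\<pi> ` ?P = L"
      using subgroup.subset[OF L(1)] unfolding surj[symmetric] by auto
    ultimately show "L = \<pi> ` H \<or> L = carrier (G Mod C)" using surj by auto
  qed (rule piH)
  have "M = {\<one>\<^bsub>G Mod C\<^esub>}" if M: "M \<lhd> G Mod C" "M \<subseteq> \<pi> ` H" for M
  proof -
    have M_sub: "subgroup M (G Mod C)" using normal_imp_subgroup[OF M(1)] .
    let ?P = "{x \<in> carrier G. \<pi> x \<in> M}"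
    have "?P \<subseteq> C" using C_largest[OF \<pi>.normal_preimage[OF M(1)]] in_H M(2) by blast
    then have "?P \<subseteq> kernel G (G Mod C) \<pi>" by (simp only: ker)
    then have "\<pi> ` ?P \<subseteq> {\<one>\<^bsub>G Mod C\<^esub>}"
      unfolding kernel_def by (intro image_subsetI) blast
    moreover have "\<pi> ` ?P = M"
      using subgroup.subset[OF M_sub] unfolding surj[symmetric] by auto
    ultimately show ?thesis using subgroup.one_closed[OF M_sub] by auto
  qed
  then have triv_core: "\<forall>M. M \<lhd> G Mod C \<longrightarrow> M \<subseteq> \<pi> ` H \<longrightarrow> M = {\<one>\<^bsub>G Mod C\<^esub>}"
    by blast
  obtain r n where r: "prime r" and index: "card (carrier (G Mod C)) = card (\<pi> ` H) * r ^ n"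
    and normal_in_H: "\<forall>S. S \<lhd> (G Mod C)\<lparr>carrier := \<pi> ` H\<rparr> \<longrightarrow> S \<noteq> {\<one>\<^bsub>G Mod C\<^esub>} \<longrightarrow>
      (\<forall>j. card S \<noteq> r ^ j) \<and>
      (\<forall>K. subgroup K (G Mod C) \<longrightarrow> S \<subseteq> K \<longrightarrow> K \<subseteq> \<pi> ` H \<longrightarrow> normalizer (G Mod C) K \<subseteq> \<pi> ` H)"
    using Q.core_free_maximal_subgroup[OF finQ solvQ maxQ triv_core]
    by (elim exE conjE) (rule that)
  \<comment> \<open>Cosets of \<open>C\<close> in \<open>H\<close> are multiplied in the same way whether they are formed in \<open>H\<close> or in \<open>G\<close>.\<close>
  have H_mod: "G\<lparr>carrier := H\<rparr> Mod core G H = (G Mod C)\<lparr>carrier := \<pi> ` H\<rparr>"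
    by (auto simp: FactGroup_def RCOSETS_def C_def \<pi>_def fun_eq_iff)
  interpret piH: group "(G Mod C)\<lparr>carrier := \<pi> ` H\<rparr>" using Q.subgroup_imp_group[OF piH] .
  have normal_p: "\<exists>S j. S \<lhd> (G Mod C)\<lparr>carrier := \<pi> ` H\<rparr> \<and> S \<noteq> {\<one>\<^bsub>G Mod C\<^esub>} \<and> card S = q ^ j"
    if "q \<in> \<omega>" for q
    using piH.fitting_prime_imp_normal_p_subgroup[of q] that assms(6) finH
    by (auto simp: H_mod)
  have r_notin: "r \<notin> \<omega>" using normal_p normal_in_H by blast
  obtain q where q: "q \<in> \<omega>" using assms(7) by blast
  then have prime_q: "prime q" using assms(6) by auto
  obtain S j where S: "S \<lhd> (G Mod C)\<lparr>carrier := \<pi> ` H\<rparr>" "S \<noteq> {\<one>\<^bsub>G Mod C\<^esub>}" "card S = q ^ j"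
    using normal_p[OF q] by blast
  have "group (G\<lparr>carrier := H\<rparr>)" using G.subgroup_imp_group[OF H_sub] .
  then obtain K where hallK: "hall_subgroup \<omega> K (G\<lparr>carrier := H\<rparr>)"
    using solvable_has_hall_subgroup[of "G\<lparr>carrier := H\<rparr>"] finH
      G.solvable_subgroup_group[OF H_sub assms(3)] by auto
  then obtain k where K: "subgroup K (G\<lparr>carrier := H\<rparr>)" "prime_factors (card K) \<subseteq> \<omega>"
    "card (carrier (G\<lparr>carrier := H\<rparr>)) = card K * k" "prime_factors k \<inter> \<omega> = {}"
    by (rule group.hall_subgroupE[OF \<open>group (G\<lparr>carrier := H\<rparr>)\<close>])
  have K_sub: "subgroup K G" using G.incl_subgroup[OF H_sub K(1)] .
  have KH: "K \<subseteq> H" using subgroup.subset[OF K(1)] by simp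
  have finK: "finite K" using finite_subset[OF KH finH] .
  have cardH: "card H = card (\<pi> ` H) * card C"
    using \<pi>.card_image_times_card_kernel[OF H_sub finH] CH by (simp add: ker Int_absorb1)
  have cardG: "card (carrier G) = card (carrier (G Mod C)) * card C"
    using \<pi>.card_image_times_card_kernel[OF G.subgroup_self fin] C.subset
    by (simp add: ker surj Int_absorb1)
  have H_pos: "card H > 0" using G.card_subgroup_pos[OF H_sub finH] .
  have k_pos: "k \<noteq> 0" using K(3) H_pos by auto
  have hall: "hall_subgroup \<omega> K G"
  proof (rule G.hall_subgroupI[OF K_sub fin K(2)])
    show "card (carrier G) = card K * (k * r ^ n)"
      using cardG cardH index K(3) by simp
    show "prime_factors (k * r ^ n) \<inter> \<omega> = {}"
      using K(4) k_pos prime_gt_0_nat[OF r] r_notin prime_factors_prime_power[OF r, of n]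
      by (auto simp: prime_factors_product)
  qed
  have piK: "subgroup (\<pi> ` K) (G Mod C)" using \<pi>.subgroup_img_is_subgroup[OF K_sub] .
  \<comment> \<open>The index of \<open>\<pi> ` K\<close> in \<open>\<pi> ` H\<close> divides the index \<open>k\<close> of \<open>K\<close> in \<open>H\<close>, hence is prime to \<open>q\<close>.\<close>
  have "S \<subseteq> \<pi> ` K"
  proof -
    have piK_H: "subgroup (\<pi> ` K) ((G Mod C)\<lparr>carrier := \<pi> ` H\<rparr>)"
      using Q.subgroup_incl[OF piK piH] KH by blast
    obtain d where d: "card (\<pi> ` H) = card (\<pi> ` K) * d"
      using Q.card_subgroup_dvd[OF piK piH] KH by blast
    have "subgroup (K \<inter> C) G" by (rule G.subgroups_Inter_pair[OF K_sub C.subgroup_axioms])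
    then obtain e where e: "card C = card (K \<inter> C) * e"
      using G.card_subgroup_dvd[OF _ C.subgroup_axioms] by blast
    have cardK: "card K = card (\<pi> ` K) * card (K \<inter> C)"
      using \<pi>.card_image_times_card_kernel[OF K_sub finK] by (simp add: ker)
    have "card K * k = card K * (d * e)"
      using K(3) cardH d e unfolding cardK by auto
    then have "k = d * e" using G.card_subgroup_pos[OF K_sub finK] by simp
    moreover have "\<not> q dvd k"
      using K(4) q prime_q k_pos by (auto simp: prime_factors_dvd)
    ultimately have "\<not> q dvd d" by auto
    then show ?thesis
      using piH.normal_p_subgroup_contained[OF _ S(1,3) prime_q piK_H, of d] d finH by simp
  qed
  then have norm_pi: "normalizer (G Mod C) (\<pi> ` K) \<subseteq> \<pi> ` H"
    using normal_in_H S(1,2) piK KH by (meson image_mono)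
  have "normalizer G K \<subseteq> H"
  proof
    fix x assume "x \<in> normalizer G K"
    then have x: "x \<in> carrier G" "\<And>y. y \<in> K \<Longrightarrow> x \<otimes>\<^bsub>G\<^esub> y \<otimes>\<^bsub>G\<^esub> inv\<^bsub>G\<^esub> x \<in> K"
      using G.in_normalizer_iff[OF K_sub finK] by auto
    have "\<pi> x \<otimes>\<^bsub>G Mod C\<^esub> \<pi> y \<otimes>\<^bsub>G Mod C\<^esub> inv\<^bsub>G Mod C\<^esub> \<pi> x \<in> \<pi> ` K" if "y \<in> K" for y
    proof -
      have yG: "y \<in> carrier G" using that KH by auto
      have "\<pi> (x \<otimes>\<^bsub>G\<^esub> y \<otimes>\<^bsub>G\<^esub> inv\<^bsub>G\<^esub> x) =
          \<pi> x \<otimes>\<^bsub>G Mod C\<^esub> \<pi> y \<otimes>\<^bsub>G Mod C\<^esub> inv\<^bsub>G Mod C\<^esub> \<pi> x"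
        using x(1) yG by (simp add: \<pi>.hom_mult del: mult_FactGroup)
      then show ?thesis using x(2)[OF that] by (metis imageI)
    qed
    then have "\<pi> x \<in> normalizer (G Mod C) (\<pi> ` K)"
      using Q.in_normalizer_iff[OF piK] finK \<pi>.hom_closed[OF x(1)] by auto
    then show "x \<in> H" using in_H[OF x(1)] norm_pi by blast
  qed
  then show ?thesis using hall by blast
qed

end
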